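(* Let $x$ and $t$ be positive integers with $x \equiv 2$ or $4 \pmod 6$. Then there exists a solution to $\mathrm{HWP}(6xt;6,2x;1,3xt-2)$.
   Context: For integers $M,N \geq 3$ and even $v$, a solution to $\mathrm{HWP}(v;M,N;\alpha,\beta)$ is a decomposition of the edge set of $K_v - F$, for some 1-factor (perfect matching) $F$ of $K_v$, into $\alpha$ $C_M$-factors and $\beta$ $C_N$-factors, where a $C_M$-factor is a spanning subgraph all of whose connected components are cycles of length $M$. *)

theory Defs
  imports Main "HOL-Library.Disjoint_Sets"
begin

text \<open>Simple graphs are given by a vertex set and a set of two-element edges. A spanning subgraph
  of the complete graph on \<open>V\<close> is therefore just a subset of \<open>complete_edges V\<close>.\<close>

definition complete_edges :: "'a set \<Rightarrow> 'a set set" where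
  "complete_edges V = {e. e \<subseteq> V \<and> card e = 2}"

definition adjacency :: "'a set set \<Rightarrow> ('a \<times> 'a) set" where
  "adjacency E = {(u, w). {u, w} \<in> E}"

text \<open>Vertex sets of the connected components; isolated vertices give singletons.\<close>

definition components_of :: "'a set \<Rightarrow> 'a set set \<Rightarrow> 'a set set" where
  "components_of V E = (\<lambda>u. {w. (u, w) \<in> (adjacency E)\<^sup>*}) ` V"

definition is_cycle_graph :: "nat \<Rightarrow> 'a set \<Rightarrow> 'a set set \<Rightarrow> bool" where
  "is_cycle_graph k C E \<longleftrightarrow> 3 \<le> k \<and>
     (\<exists>c. bij_betw c {..<k} C \<and> E = {{c i, c (Suc i mod k)} | i. i < k})"

definition cycle_factor :: "nat \<Rightarrow> 'a set \<Rightarrow> 'a set set \<Rightarrow> bool" where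
  "cycle_factor k V E \<longleftrightarrow> E \<subseteq> complete_edges V \<and>
     (\<forall>C \<in> components_of V E. is_cycle_graph k C {e \<in> E. e \<subseteq> C})"

definition one_factor :: "'a set \<Rightarrow> 'a set set \<Rightarrow> bool" where
  "one_factor V F \<longleftrightarrow> F \<subseteq> complete_edges V \<and> (\<forall>u \<in> V. \<exists>!e. e \<in> F \<and> u \<in> e)"

text \<open>The factors are \<open>G 0, \<dots>, G (a + b - 1)\<close>; indexing them keeps the two kinds
  apart even when \<open>M = N\<close>.\<close>

definition HWP_solution ::
  "nat \<Rightarrow> nat \<Rightarrow> nat \<Rightarrow> nat \<Rightarrow> nat \<Rightarrow> nat set set \<Rightarrow> (nat \<Rightarrow> nat set set) \<Rightarrow> bool" where
  "HWP_solution v M N a b F G \<longleftrightarrow>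
     3 \<le> M \<and> 3 \<le> N \<and> even v \<and>
     one_factor {..<v} F \<and>
     (\<forall>i < a. cycle_factor M {..<v} (G i)) \<and>
     (\<forall>i \<in> {a..<a + b}. cycle_factor N {..<v} (G i)) \<and>
     disjoint_family_on G {..<a + b} \<and>
     (\<Union>i < a + b. G i) = complete_edges {..<v} - F"

end

theory Submission
  imports Defs
begin

text \<open>Write \<open>x = 2 h\<close> and \<open>k = 3 h t\<close>, and view the \<open>4 k\<close> points as two copies of each vertex of the
  complete graph on \<open>2 k\<close> vertices. The latter is factored by sums modulo \<open>2 k - 1\<close>; consecutive
  factors form Hamiltonian cycles, and a doubled cycle whose length is a multiple of \<open>x\<close> splits into
  two factors with cycles of length \<open>2 x\<close> (Haggkvist). Three consecutive factors are left over. They form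
  a ladder, closed up at its ends, and the doubled ladder together with the pairs of copies is a
  7-regular graph which, for \<open>h \<ge> 2\<close>, is decomposed explicitly: hexagons and the 1-factor are
  repeated every three columns, while the rest splits into two strips of parallel strands that can
  be cut after every \<open>h\<close> columns by a local exchange. For \<open>h = 1\<close> any 1-factor between groups of six
  points carries factors into squares, so that it suffices to treat the complete graph on twelve
  points.\<close>

section \<open>Factorizations from edge labellings\<close>

text \<open>Three factors are held back because the number \<open>2 * k - 1\<close> of factors is
  odd, while a single doubled factor with the pairs of copies is a disjoint union of complete graphs
  on four points, which has no room for hexagons. Consecutive sums make the union of the three a
  ladder, so what remains is a pattern along its columns and a repair at each end. The degree splits
  as 7 = 2 + 2 + 2 + 1: hexagons, two long factors, 1-factor. Each long factor closes by itself at
  one end of the ladder, where the doubled end vertex supplies just the two points that its strands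
  need; at the other end it is diverted through the end column, using an edge that the periodic
  pattern would give to the 1-factor. These repairs occupy the columns \<open>1\<close> and
  \<open>k - 1\<close>, which are not cuts when \<open>h \<ge> 2\<close>, since \<open>h\<close>
  divides \<open>k\<close>. For \<open>h = 1\<close> every column would be a cut, hence the separate
  treatment of squares.\<close>

definition tiles :: "nat \<Rightarrow> 'a set \<Rightarrow> ('a \<Rightarrow> 'a \<Rightarrow> bool) \<Rightarrow> 'a list list \<Rightarrow> bool" where
  "tiles L V P cs \<longleftrightarrow>
     (\<forall>xs \<in> set cs. length xs = L \<and> (\<forall>n < L. P (xs ! n) (xs ! (Suc n mod L)))) \<and>
     (\<Union>xs \<in> set cs. set xs) = V \<and> length cs * L = card V"

text \<open>Covering \<open>V\<close> with \<open>length cs * L = card V\<close> entries forces all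
  entries to be distinct, within a cycle and across cycles. For \<open>L = 2\<close> each closed
  walk runs along one edge and back, which is how 1-factors are handled.\<close>

lemma tiles_bij:
  assumes "tiles L V P cs" and "finite V"
  shows "bij_betw (\<lambda>(r, n). cs ! r ! n) ({..<length cs} \<times> {..<L}) V"
proof -
  let ?f = "\<lambda>(r, n). cs ! r ! n"
  have len: "length (cs ! r) = L" if "r < length cs" for r
    using assms(1) that by (auto simp: tiles_def)
  have V: "(\<Union>xs \<in> set cs. set xs) = V" and card: "length cs * L = card V"
    using assms(1) by (auto simp: tiles_def)
  have im: "?f ` ({..<length cs} \<times> {..<L}) = V"
  proof (intro equalityI subsetI)
    fix u assume "u \<in> V"
    then obtain xs where "xs \<in> set cs" "u \<in> set xs" using V by auto
    then obtain r n where "r < length cs" "xs = cs ! r" "n < length xs" "u = xs ! n"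
      by (metis in_set_conv_nth)
    then show "u \<in> ?f ` ({..<length cs} \<times> {..<L})"
      using len by (auto intro!: image_eqI[of _ _ "(r, n)"])
  next
    fix u assume "u \<in> ?f ` ({..<length cs} \<times> {..<L})"
    then obtain r n where rn: "r < length cs" "n < L" "u = cs ! r ! n" by auto
    then have "cs ! r \<in> set cs" "u \<in> set (cs ! r)" using len by simp_all
    then show "u \<in> V" using V by blast
  qed
  have "inj_on ?f ({..<length cs} \<times> {..<L})"
    by (rule eq_card_imp_inj_on) (simp_all add: im card)
  with im show ?thesis by (simp add: bij_betw_def)
qed

section \<open>Edge sets of cycle factors and of 1-factors\<close>

definition cycle_edges :: "('i \<times> nat \<Rightarrow> 'a) \<Rightarrow> 'i set \<Rightarrow> nat \<Rightarrow> 'a set set" where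
  "cycle_edges f I L = (\<lambda>(r, n). {f (r, n), f (r, Suc n mod L)}) ` (I \<times> {..<L})"

lemma in_cycle_edges:
  "e \<in> cycle_edges f I L \<longleftrightarrow> (\<exists>r \<in> I. \<exists>n < L. e = {f (r, n), f (r, Suc n mod L)})"
  by (auto simp: cycle_edges_def)

lemma Suc_mod_eq_self: "n < L \<Longrightarrow> Suc n mod L = n \<Longrightarrow> L = 1"
  by (cases "Suc n = L") auto

lemma Suc_mod_swap: "n < L \<Longrightarrow> m < L \<Longrightarrow> Suc n mod L = m \<Longrightarrow> Suc m mod L = n \<Longrightarrow> L \<le> 2"
  by (cases "Suc n = L"; cases "Suc m = L") auto

lemma cycle_edges_subset:
  assumes f: "bij_betw f (I \<times> {..<L}) V" and L: "2 \<le> L"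
  shows "cycle_edges f I L \<subseteq> complete_edges V"
proof
  fix e assume "e \<in> cycle_edges f I L"
  then obtain r n where rn: "r \<in> I" "n < L" "e = {f (r, n), f (r, Suc n mod L)}"
    by (auto simp: cycle_edges_def)
  have in1: "(r, n) \<in> I \<times> {..<L}" and in2: "(r, Suc n mod L) \<in> I \<times> {..<L}"
    using rn by auto
  have "n \<noteq> Suc n mod L" using Suc_mod_eq_self[OF rn(2)] L by fastforce
  then have "f (r, n) \<noteq> f (r, Suc n mod L)"
    using bij_betw_imp_inj_on[OF f] in1 in2 by (meson Pair_inject inj_on_eq_iff)
  then show "e \<in> complete_edges V"
    using rn(3) in1 in2 f by (auto simp: complete_edges_def bij_betw_def)
qed

text \<open>Two positions could give the same edge only if each were the cyclic successor of the
  other, which \<open>Suc_mod_swap\<close> excludes for \<open>L \<ge> 3\<close>.\<close>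

lemma card_cycle_edges:
  assumes f: "bij_betw f (I \<times> {..<L}) V" and L: "3 \<le> L" and "finite V"
  shows "card (cycle_edges f I L) = card V"
proof -
  have inj: "inj_on f (I \<times> {..<L})" using f by (simp add: bij_betw_def)
  have "inj_on (\<lambda>(r, n). {f (r, n), f (r, Suc n mod L)}) (I \<times> {..<L})"
  proof (rule inj_onI, simp only: split_paired_all split_conv mem_Times_iff fst_conv snd_conv prod.inject)
    fix r n s m
    assume "r \<in> I \<and> n \<in> {..<L}" "s \<in> I \<and> m \<in> {..<L}"
      and eq: "{f (r, n), f (r, Suc n mod L)} = {f (s, m), f (s, Suc m mod L)}"
    then have A: "r \<in> I" "n < L" "s \<in> I" "m < L" by auto
    have M: "Suc n mod L < L" "Suc m mod L < L" using A by auto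
    have I: "f (r, i) = f (s, j) \<longleftrightarrow> r = s \<and> i = j" if "i < L" "j < L" for i j
      using inj_on_eq_iff[OF inj, of "(r, i)" "(s, j)"] A that by auto
    from eq have "f (r, n) = f (s, m) \<or> f (r, n) = f (s, Suc m mod L) \<and> f (r, Suc n mod L) = f (s, m)"
      unfolding doubleton_eq_iff by blast
    then have "r = s \<and> n = m \<or> n = Suc m mod L \<and> Suc n mod L = m"
      using I[OF A(2,4)] I[OF A(2) M(2)] I[OF M(1) A(4)] by blast
    then show "r = s \<and> n = m"
      using Suc_mod_swap[OF A(2,4)] L by auto
  qed
  then show ?thesis
    using bij_betw_same_card[OF f] by (simp add: cycle_edges_def card_image)
qed

text \<open>The component of \<open>f (r, n)\<close> is row \<open>r\<close>: edges never leave a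
  row (\<open>adj\<close>), and stepping forward cyclically reaches all of it
  (\<open>step\<close>).\<close>

lemma cycle_factor_cycle_edges:
  assumes f: "bij_betw f (I \<times> {..<L}) V" and L: "3 \<le> L"
  shows "cycle_factor L V (cycle_edges f I L)"
proof -
  let ?E = "cycle_edges f I L"
  have inj: "inj_on f (I \<times> {..<L})" and im: "f ` (I \<times> {..<L}) = V"
    using bij_betw_imp_inj_on[OF f] bij_betw_imp_surj_on[OF f] .
  have I: "f (r, i) = f (s, j) \<longleftrightarrow> r = s \<and> i = j"
    if "r \<in> I" "s \<in> I" "i < L" "j < L" for r s i j
    using inj_on_eq_iff[OF inj, of "(r, i)" "(s, j)"] that by auto
  have adj: "w \<in> f ` ({r} \<times> {..<L})"
    if r: "r \<in> I" and u: "u \<in> f ` ({r} \<times> {..<L})" and e: "{u, w} \<in> ?E" for r u w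
  proof -
    obtain n where n: "n < L" "u = f (r, n)" using u by auto
    obtain s m where s: "s \<in> I" "m < L" "{u, w} = {f (s, m), f (s, Suc m mod L)}"
      using e unfolding in_cycle_edges by blast
    have m: "Suc m mod L < L" using s by auto
    from s(3) have uw: "u = f (s, m) \<and> w = f (s, Suc m mod L) \<or> u = f (s, Suc m mod L) \<and> w = f (s, m)"
      unfolding doubleton_eq_iff by blast
    then have "f (r, n) = f (s, m) \<or> f (r, n) = f (s, Suc m mod L)" using n(2) by auto
    then have "s = r" using I[OF r s(1) n(1) s(2)] I[OF r s(1) n(1) m] by blast
    from uw have "w = f (r, m) \<or> w = f (r, Suc m mod L)" unfolding \<open>s = r\<close> by blast
    then show ?thesis using s(2) m by blast
  qed
  have comp: "{w. (u, w) \<in> (adjacency ?E)\<^sup>*} = f ` ({r} \<times> {..<L})"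
    if r: "r \<in> I" and n: "n < L" and u: "u = f (r, n)" for r n u
  proof (intro equalityI subsetI)
    fix w assume "w \<in> {w. (u, w) \<in> (adjacency ?E)\<^sup>*}"
    then have "(u, w) \<in> (adjacency ?E)\<^sup>*" by simp
    then show "w \<in> f ` ({r} \<times> {..<L})"
    proof induction
      case base then show ?case using n u by auto
    next
      case (step y z) then show ?case using adj[OF r, of y z] by (simp add: adjacency_def)
    qed
  next
    have edge: "(f (r, i), f (r, Suc i mod L)) \<in> adjacency ?E" if "i < L" for i
      using r that unfolding adjacency_def in_cycle_edges by blast
    have step: "(f (r, n), f (r, (n + d) mod L)) \<in> (adjacency ?E)\<^sup>*" for d
    proof (induction d)
      case 0 then show ?case using n by simp
    next
      case (Suc d)
      have "(f (r, (n + d) mod L), f (r, Suc ((n + d) mod L) mod L)) \<in> adjacency ?E"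
        using n by (intro edge) auto
      with Suc have "(f (r, n), f (r, Suc ((n + d) mod L) mod L)) \<in> (adjacency ?E)\<^sup>*"
        by (rule rtrancl_into_rtrancl)
      then show ?case by (simp add: mod_Suc_eq)
    qed
    fix w assume "w \<in> f ` ({r} \<times> {..<L})"
    then obtain i where i: "i < L" "w = f (r, i)" by auto
    have "(n + (L - n + i)) mod L = i" using n i by simp
    with step[of "L - n + i"] i u show "w \<in> {w. (u, w) \<in> (adjacency ?E)\<^sup>*}" by simp
  qed
  have "is_cycle_graph L C {e \<in> ?E. e \<subseteq> C}" if C: "C \<in> components_of V ?E" for C
  proof -
    obtain u where u: "u \<in> V" "C = {w. (u, w) \<in> (adjacency ?E)\<^sup>*}"
      using C unfolding components_of_def by blast
    obtain r n where rn: "r \<in> I" "n < L" "u = f (r, n)"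
      using u(1) im by auto
    have C: "C = f ` ({r} \<times> {..<L})" using comp[OF rn] u(2) by simp
    have "inj_on (\<lambda>n. f (r, n)) {..<L}"
      using I[OF rn(1) rn(1)] by (auto simp: inj_on_def)
    then have "bij_betw (\<lambda>n. f (r, n)) {..<L} C"
      unfolding bij_betw_def C by auto
    moreover have "{e \<in> ?E. e \<subseteq> C} = {{f (r, i), f (r, Suc i mod L)} |i. i < L}"
    proof (intro equalityI subsetI)
      fix e assume "e \<in> {e \<in> ?E. e \<subseteq> C}"
      then obtain s m where s: "s \<in> I" "m < L" "e = {f (s, m), f (s, Suc m mod L)}" "f (s, m) \<in> C"
        unfolding in_cycle_edges by blast
      then obtain i where "i < L" "f (s, m) = f (r, i)" using C by blast
      then have "s = r" using I[OF s(1) rn(1) s(2)] by blast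
      then show "e \<in> {{f (r, i), f (r, Suc i mod L)} |i. i < L}" using s by auto
    next
      fix e assume "e \<in> {{f (r, i), f (r, Suc i mod L)} |i. i < L}"
      then obtain i where "i < L" "e = {f (r, i), f (r, Suc i mod L)}" by auto
      moreover from this have "Suc i mod L < L" by auto
      ultimately show "e \<in> {e \<in> ?E. e \<subseteq> C}"
        using rn(1) C unfolding in_cycle_edges by blast
    qed
    ultimately show ?thesis unfolding is_cycle_graph_def using L by blast
  qed
  then show ?thesis
    unfolding cycle_factor_def using cycle_edges_subset[OF f] L by auto
qed

lemma cycle_edges_2: "cycle_edges f I 2 = (\<lambda>r. {f (r, 0), f (r, 1)}) ` I"
proof -
  have "(\<exists>n < 2. e = {f (r, n), f (r, Suc n mod 2)}) \<longleftrightarrow> e = {f (r, 0), f (r, 1)}" for e r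
    by (auto simp: less_2_cases_iff insert_commute)
  then show ?thesis by (intro set_eqI) (simp only: in_cycle_edges image_iff)
qed

lemma one_factor_cycle_edges:
  assumes f: "bij_betw f (I \<times> {..<2}) V"
  shows "one_factor V (cycle_edges f I 2)"
proof -
  have inj: "inj_on f (I \<times> {..<2})" and im: "f ` (I \<times> {..<2}) = V"
    using bij_betw_imp_inj_on[OF f] bij_betw_imp_surj_on[OF f] .
  have I: "f (r, i) = f (s, j) \<longleftrightarrow> r = s \<and> i = j"
    if "r \<in> I" "s \<in> I" "i < 2" "j < 2" for r s i j
    using inj_on_eq_iff[OF inj, of "(r, i)" "(s, j)"] that by auto
  note E = cycle_edges_2[of f I]
  have "\<exists>!e. e \<in> cycle_edges f I 2 \<and> u \<in> e" if u: "u \<in> V" for u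
  proof -
    obtain r n where rn: "r \<in> I" "n < 2" "u = f (r, n)" using u im by auto
    show ?thesis
    proof (rule ex1I[of _ "{f (r, 0), f (r, 1)}"])
      show "{f (r, 0), f (r, 1)} \<in> cycle_edges f I 2 \<and> u \<in> {f (r, 0), f (r, 1)}"
        using rn E by (auto simp: less_2_cases_iff)
    next
      fix e assume "e \<in> cycle_edges f I 2 \<and> u \<in> e"
      then obtain s where "s \<in> I" "e = {f (s, 0), f (s, 1)}" "u \<in> e" using E by auto
      then show "e = {f (r, 0), f (r, 1)}" using rn I[of s r 0 n] I[of s r 1 n] by auto
    qed
  qed
  then show ?thesis
    unfolding one_factor_def using cycle_edges_subset[OF f] by auto
qed

lemma card_cycle_edges_2:
  assumes f: "bij_betw f (I \<times> {..<2}) V" and "finite V"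
  shows "2 * card (cycle_edges f I 2) = card V"
proof -
  have inj: "inj_on f (I \<times> {..<2})" using f by (simp add: bij_betw_def)
  have I: "f (r, i) = f (s, j) \<longleftrightarrow> r = s \<and> i = j"
    if "r \<in> I" "s \<in> I" "i < 2" "j < 2" for r s i j
    using inj_on_eq_iff[OF inj, of "(r, i)" "(s, j)"] that by auto
  note E = cycle_edges_2[of f I]
  have "inj_on (\<lambda>r. {f (r, 0), f (r, 1)}) I"
    by (rule inj_onI) (auto simp: doubleton_eq_iff I)
  then have "card (cycle_edges f I 2) = card I" by (simp add: E card_image)
  moreover have "card V = card I * 2"
    using bij_betw_same_card[OF f] by (simp add: card_cartesian_product)
  ultimately show ?thesis by simp
qed

text \<open>Only disjointness of the factors has to be certified, by a symmetric edge labelling: counting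
  edges then shows that the factors exhaust the complete graph.\<close>

lemma HWP_solutionI:
  fixes V :: "'a set" and lab :: "'a \<Rightarrow> 'a \<Rightarrow> nat"
  assumes fin: "finite V" and card: "card V = 2 * (a + b) + 2" and MN: "3 \<le> M" "3 \<le> N"
    and sym: "\<And>u w. lab u w = lab w u"
    and tM: "\<And>i. i < a \<Longrightarrow> \<exists>cs. tiles M V (\<lambda>u w. lab u w = i) cs"
    and tN: "\<And>i. a \<le> i \<Longrightarrow> i < a + b \<Longrightarrow> \<exists>cs. tiles N V (\<lambda>u w. lab u w = i) cs"
    and tF: "\<exists>cs. tiles 2 V (\<lambda>u w. lab u w = a + b) cs"
  shows "\<exists>F G. HWP_solution (card V) M N a b F G"
proof -
  \<comment> \<open>The index \<open>a + b\<close>, past all the factors, stands for the 1-factor,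
    treated as closed walks of length 2.\<close>
  define L where "L i = (if i < a then M else if i < a + b then N else 2)" for i
  have "\<exists>cs. tiles (L i) V (\<lambda>u w. lab u w = i) cs" if "i \<le> a + b" for i
    using tM tN tF that by (cases "i < a"; cases "i < a + b") (auto simp: L_def)
  then obtain cs where cs: "\<And>i. i \<le> a + b \<Longrightarrow> tiles (L i) V (\<lambda>u w. lab u w = i) (cs i)"
    by metis
  obtain g where g: "bij_betw g V {..<card V}"
    using ex_bij_betw_finite_nat[OF fin] by (auto simp: atLeast0LessThan)
  define I where "I i = {..<length (cs i)}" for i
  define f where "f i = g \<circ> (\<lambda>(r, n). cs i ! r ! n)" for i
  define G where "G i = cycle_edges (f i) (I i) (L i)" for i
  have f: "bij_betw (f i) (I i \<times> {..<L i}) {..<card V}" if "i \<le> a + b" for i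
    unfolding f_def I_def using bij_betw_trans[OF tiles_bij[OF cs[OF that] fin] g] .
  have L: "2 \<le> L i" for i using MN by (simp add: L_def)
  have L3: "3 \<le> L i" if "i < a + b" for i using MN that by (simp add: L_def)
  have lab: "lab (inv_into V g u) (inv_into V g w) = i"
    if i: "i \<le> a + b" and e: "{u, w} \<in> G i" for i u w
  proof -
    obtain r n where rn: "r < length (cs i)" "n < L i"
      "{u, w} = {g (cs i ! r ! n), g (cs i ! r ! (Suc n mod L i))}"
      using e unfolding G_def in_cycle_edges f_def I_def by auto
    have xs: "cs i ! r \<in> set (cs i)" "length (cs i ! r) = L i"
      "(\<Union>xs \<in> set (cs i). set xs) = V" "lab (cs i ! r ! n) (cs i ! r ! (Suc n mod L i)) = i"
      using cs[OF i] rn by (auto simp: tiles_def)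
    have "Suc n mod L i < L i" using rn(2) by auto
    then have "cs i ! r ! n \<in> set (cs i ! r)" "cs i ! r ! (Suc n mod L i) \<in> set (cs i ! r)"
      using xs(2) rn(2) by simp_all
    then have "cs i ! r ! n \<in> V" "cs i ! r ! (Suc n mod L i) \<in> V"
      using xs(1,3) by blast+
    then have "inv_into V g (g (cs i ! r ! n)) = cs i ! r ! n"
      "inv_into V g (g (cs i ! r ! (Suc n mod L i))) = cs i ! r ! (Suc n mod L i)"
      using g by (auto simp: bij_betw_def)
    then show ?thesis using rn(3) xs(4) sym unfolding doubleton_eq_iff by auto
  qed
  have sub: "G i \<subseteq> complete_edges {..<card V}" if "i \<le> a + b" for i
    unfolding G_def using cycle_edges_subset[OF f[OF that] L] .
  have finC: "finite (complete_edges {..<card V})"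
    by (rule finite_subset[of _ "Pow {..<card V}"]) (auto simp: complete_edges_def)
  have disj: "G i \<inter> G j = {}" if ij: "i \<le> a + b" "j \<le> a + b" "i \<noteq> j" for i j
  proof (rule ccontr)
    assume "G i \<inter> G j \<noteq> {}"
    then obtain e where e: "e \<in> G i" "e \<in> G j" by auto
    then obtain u w where "e = {u, w}" by (auto simp: G_def cycle_edges_def)
    then show False using lab[OF ij(1), of u w] lab[OF ij(2), of u w] e ij(3) by simp
  qed
  have cardG: "card (G i) = card V" if "i < a + b" for i
    unfolding G_def using card_cycle_edges[OF f L3] that by simp
  have La: "L (a + b) = 2" by (simp add: L_def)
  have f2: "bij_betw (f (a + b)) (I (a + b) \<times> {..<2}) {..<card V}"
    using f[of "a + b"] La by simp
  have cardF: "card (G (a + b)) = a + b + 1"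
    using card_cycle_edges_2[OF f2] card by (simp add: G_def La)
  have cardC: "card (complete_edges {..<card V}) = card V * (card V - 1) div 2"
    using n_subsets[of "{..<card V}" 2] by (simp add: complete_edges_def choose_two)
  have "card (\<Union>i\<in>{..a + b}. G i) = (\<Sum>i\<in>{..a + b}. card (G i))"
    using disj finite_subset[OF sub finC] by (intro card_UN_disjoint) auto
  also have "\<dots> = (\<Sum>i<a + b. card (G i)) + card (G (a + b))"
    by (simp add: lessThan_Suc_atMost[symmetric])
  also have "\<dots> = (a + b) * card V + (a + b + 1)"
    using cardG cardF by simp
  also have "\<dots> = card (complete_edges {..<card V})"
  proof -
    have "card V * (card V - 1) = 2 * ((a + b) * card V + (a + b + 1))"
      unfolding card by (simp add: algebra_simps)
    then show ?thesis unfolding cardC by simp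
  qed
  finally have "(\<Union>i\<in>{..a + b}. G i) = complete_edges {..<card V}"
    using sub finC by (intro card_subset_eq) auto
  moreover have "(\<Union>i\<in>{..a + b}. G i) = (\<Union>i<a + b. G i) \<union> G (a + b)"
    by (auto simp: lessThan_Suc_atMost[symmetric] lessThan_Suc)
  moreover have "(\<Union>i<a + b. G i) \<inter> G (a + b) = {}"
  proof -
    have "G i \<inter> G (a + b) = {}" if "i < a + b" for i using disj[of i "a + b"] that by simp
    then show ?thesis by blast
  qed
  ultimately have un: "(\<Union>i<a + b. G i) = complete_edges {..<card V} - G (a + b)" by blast
  have cf: "cycle_factor (L i) {..<card V} (G i)" if "i < a + b" for i
    unfolding G_def using cycle_factor_cycle_edges[OF f L3] that by simp
  have "cycle_factor M {..<card V} (G i)" if "i < a" for i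
    using cf[of i] that by (simp add: L_def)
  moreover have "cycle_factor N {..<card V} (G i)" if "i \<in> {a..<a + b}" for i
    using cf[of i] that by (simp add: L_def)
  moreover have "one_factor {..<card V} (G (a + b))"
    unfolding G_def La by (rule one_factor_cycle_edges[OF f2])
  moreover have "disjoint_family_on G {..<a + b}"
    using disj by (auto simp: disjoint_family_on_def)
  ultimately have "HWP_solution (card V) M N a b (G (a + b)) G"
    unfolding HWP_solution_def using MN un card by simp
  then show ?thesis by blast
qed

text \<open>The lists have \<open>card V\<close> entries in all, so once they cover \<open>V\<close>
  they cannot reach beyond it. Appending the head turns the cyclic condition into
  \<open>successively\<close>, which simplification evaluates on explicit lists.\<close>

lemma tilesI:
  assumes "\<And>xs. xs \<in> set cs \<Longrightarrow> length xs = L" and "0 < L"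
    and "\<And>xs. xs \<in> set cs \<Longrightarrow> successively P (xs @ [hd xs])"
    and V: "V \<subseteq> (\<Union>xs \<in> set cs. set xs)" and card: "length cs * L = card V"
  shows "tiles L V P cs"
proof -
  have "length (concat cs) = length cs * L"
    using assms(1) by (induction cs) auto
  then have "card (\<Union>xs \<in> set cs. set xs) \<le> card V"
    using card_length[of "concat cs"] card by simp
  then have un: "(\<Union>xs \<in> set cs. set xs) = V"
    using card_seteq[OF _ V] by simp
  have "P (xs ! n) (xs ! (Suc n mod L))" if xs: "xs \<in> set cs" and n: "n < L" for xs n
  proof -
    have len: "length xs = L" using assms(1) xs .
    have "P ((xs @ [hd xs]) ! n) ((xs @ [hd xs]) ! Suc n)"
      using assms(3)[OF xs] n len by (simp add: successively_conv_nth)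
    moreover have "(xs @ [hd xs]) ! n = xs ! n" using n len by (simp add: nth_append)
    moreover have "(xs @ [hd xs]) ! Suc n = xs ! (Suc n mod L)"
      using n len by (cases "Suc n = L"; cases xs) (use n len in \<open>auto simp: nth_append hd_conv_nth\<close>)
    ultimately show ?thesis by simp
  qed
  then show ?thesis unfolding tiles_def using assms(1) un card by blast
qed

lemma tiles_map:
  assumes t: "tiles L V P cs" and inj: "inj_on g V"
    and P: "\<And>u w. u \<in> V \<Longrightarrow> w \<in> V \<Longrightarrow> P u w \<Longrightarrow> Q (g u) (g w)"
  shows "tiles L (g ` V) Q (map (map g) cs)"
proof -
  have V: "(\<Union>xs \<in> set cs. set xs) = V" using t by (simp add: tiles_def)
  have "Q (map g xs ! n) (map g xs ! (Suc n mod L))"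
    if xs: "xs \<in> set cs" and n: "n < L" for xs n
  proof -
    have len: "length xs = L" and p: "P (xs ! n) (xs ! (Suc n mod L))"
      using t xs n by (auto simp: tiles_def)
    have "Suc n mod L < L" using n by simp
    moreover have "set xs \<subseteq> V" using V xs by blast
    ultimately show ?thesis using P[OF _ _ p] n len by (simp add: subset_iff)
  qed
  moreover have "(\<Union>xs \<in> set (map (map g) cs). set xs) = g ` V" using V by auto
  moreover have "card (g ` V) = card V" using inj by (rule card_image)
  ultimately show ?thesis using t by (auto simp: tiles_def)
qed

section \<open>Closed walks made of two strands\<close>

lemma successively_map_upt:
  "(\<And>i. m \<le> i \<Longrightarrow> Suc i < n \<Longrightarrow> P (f i) (f (Suc i))) \<Longrightarrow> successively P (map f [m..<n])"
  by (simp add: successively_conv_nth)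

text \<open>Out along \<open>S\<close>, across by \<open>xs\<close>, back along \<open>T\<close>,
  across by \<open>ys\<close>. The detours are empty except where a cycle is diverted through an end
  column of the ladder.\<close>

definition strand_cycle ::
    "(nat \<Rightarrow> 'a) \<Rightarrow> (nat \<Rightarrow> 'a) \<Rightarrow> nat \<Rightarrow> nat \<Rightarrow> 'a list \<Rightarrow> 'a list \<Rightarrow> 'a list" where
  "strand_cycle S T m n xs ys = map S [m..<n] @ xs @ rev (map T [m..<n]) @ ys"

lemma length_strand_cycle [simp]:
  "length (strand_cycle S T m n xs ys) = 2 * (n - m) + length xs + length ys"
  by (simp add: strand_cycle_def)

lemma set_strand_cycle [simp]:
  "set (strand_cycle S T m n xs ys) = S ` {m..<n} \<union> T ` {m..<n} \<union> set xs \<union> set ys"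
  by (auto simp: strand_cycle_def)

lemma successively_strand_cycle:
  assumes "m < n" and sym: "\<And>u w. P u w \<Longrightarrow> P w u"
    and S: "\<And>i. m \<le> i \<Longrightarrow> Suc i < n \<Longrightarrow> P (S i) (S (Suc i))"
    and T: "\<And>i. m \<le> i \<Longrightarrow> Suc i < n \<Longrightarrow> P (T i) (T (Suc i))"
    and xs: "successively P (S (n - 1) # xs @ [T (n - 1)])"
    and ys: "successively P (T m # ys @ [S m])"
  shows "successively P (strand_cycle S T m n xs ys @ [hd (strand_cycle S T m n xs ys)])"
proof -
  define A where "A = map S [m..<n]"
  define B where "B = rev (map T [m..<n])"
  have A: "A \<noteq> []" "hd A = S m" "last A = S (n - 1)"
    using \<open>m < n\<close> by (auto simp: A_def hd_map last_map)
  have B: "B \<noteq> []" "hd B = T (n - 1)" "last B = T m"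
    using \<open>m < n\<close> by (auto simp: B_def hd_map last_map hd_rev last_rev)
  have "successively P A" unfolding A_def using S by (rule successively_map_upt)
  moreover have "successively P B"
    unfolding B_def successively_rev using T sym by (intro successively_map_upt) blast
  moreover have "successively P (S (n - 1) # xs @ B)"
    using xs B \<open>successively P B\<close> by (cases "xs = []") (auto simp: successively_append_iff successively_Cons)
  moreover have "successively P (T m # ys @ [S m])" by (rule ys)
  ultimately have "successively P (A @ xs @ B @ ys @ [S m])"
    using A B by (cases "xs = []"; cases "ys = []") (auto simp: successively_append_iff successively_Cons)
  then show ?thesis using A by (simp add: strand_cycle_def A_def B_def)
qed

section \<open>Doubled cycles and the sum factorization\<close>

text \<open>Haggkvist's doubling. Replacing every vertex of a cycle of length \<open>m\<close> by two copies gives a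
  4-regular graph on pairs (layer, copy). If \<open>x\<close> divides \<open>m\<close> and is even, the edges obeying
  \<open>dbl_rule\<close> form cycles of length \<open>2 x\<close>, and flipping the copies in the even layers exchanges
  them with the remaining edges.\<close>

definition dbl_rule :: "nat \<Rightarrow> nat \<Rightarrow> bool \<Rightarrow> bool \<Rightarrow> bool" where
  "dbl_rule x l c c' \<longleftrightarrow> (if x dvd l then c else if x dvd Suc l then \<not> c' else c = c')"

definition dbl_adj ::
    "nat \<Rightarrow> (nat \<Rightarrow> bool \<Rightarrow> bool \<Rightarrow> bool) \<Rightarrow> nat \<times> bool \<Rightarrow> nat \<times> bool \<Rightarrow> bool" where
  "dbl_adj m R u w \<longleftrightarrow>
     fst w = Suc (fst u) mod m \<and> R (fst u) (snd u) (snd w) \<or>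
     fst u = Suc (fst w) mod m \<and> R (fst w) (snd w) (snd u)"

lemma dbl_adj_sym: "dbl_adj m R u w \<Longrightarrow> dbl_adj m R w u"
  by (auto simp: dbl_adj_def)

text \<open>A layer that \<open>x\<close> divides is a bottleneck: its copy \<open>True\<close> is
  joined to both copies in the next layer, its copy \<open>False\<close> to both in the preceding
  one, and in between the copies run parallel. So block \<open>r\<close>, from layer
  \<open>x * r\<close> to the next bottleneck, closes up to one cycle on
  \<open>1 + 2 * (x - 1) + 1\<close> points.\<close>

lemma tiles_doubled_cycle:
  assumes x: "2 \<le> x" and s: "0 < s"
  shows "\<exists>cs. tiles (2 * x) ({..<x * s} \<times> UNIV) (dbl_adj (x * s) (dbl_rule x)) cs"
proof -
  let ?m = "x * s" and ?P = "dbl_adj (x * s) (dbl_rule x)"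
  \<comment> \<open>\<open>S r\<close> starts at the bottleneck and goes on along the copies
    \<open>False\<close>; \<open>T r\<close> is one layer ahead, runs along the copies
    \<open>True\<close> and ends in the next bottleneck.\<close>
  define S where "S r n = (x * r + n, n = 0)" for r n :: nat
  define T where "T r n = ((x * r + Suc n) mod ?m, Suc n \<noteq> x)" for r n :: nat
  define cs where "cs = map (\<lambda>r. strand_cycle (S r) (T r) 0 x [] []) [0..<s]"
  have less: "x * r + n < ?m" if "r < s" "n < x" for r n
  proof -
    have "x * r + n < x * Suc r" using that by simp
    also have "\<dots> \<le> ?m" using that by (intro mult_le_mono) auto
    finally show ?thesis .
  qed
  have dvd: "x dvd n \<longleftrightarrow> n = 0" if "n < x" for n using that by (auto dest: dvd_imp_le)
  have add: "x dvd x * r + n \<longleftrightarrow> x dvd n" "x dvd Suc (x * r + n) \<longleftrightarrow> x dvd Suc n" for r n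
    using dvd_add_right_iff[of x "x * r" n] dvd_add_right_iff[of x "x * r" "Suc n"] by simp_all
  have "successively ?P (strand_cycle (S r) (T r) 0 x [] [] @ [hd (strand_cycle (S r) (T r) 0 x [] [])])"
    if r: "r < s" for r
  proof (rule successively_strand_cycle)
    show "?P (S r i) (S r (Suc i))" if "Suc i < x" for i
      using less[OF r that] that dvd[of i] dvd[of "Suc i"]
      by (auto simp: S_def dbl_adj_def dbl_rule_def add)
    show "?P (T r i) (T r (Suc i))" if "Suc i < x" for i
      using less[OF r that] that dvd[of "Suc i"] dvd[of "Suc (Suc i)"]
      by (cases "Suc (Suc i) = x") (auto simp: T_def dbl_adj_def dbl_rule_def add[of _ "Suc _", simplified])
    show "successively ?P (S r (x - 1) # [] @ [T r (x - 1)])"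
      using x less[OF r, of "x - 1"] dvd[of "x - 1"] add(1)[of r "x - 1"]
      by (auto simp: S_def T_def dbl_adj_def dbl_rule_def add)
    show "successively ?P (T r 0 # [] @ [S r 0])"
      using x less[OF r, of 1] by (auto simp: S_def T_def dbl_adj_def dbl_rule_def add)
  qed (use x in \<open>auto intro: dbl_adj_sym\<close>)
  moreover have "{..<?m} \<times> UNIV \<subseteq> (\<Union>xs \<in> set cs. set xs)" (is "_ \<subseteq> ?U")
  proof
    fix u :: "nat \<times> bool" assume "u \<in> {..<?m} \<times> UNIV"
    then obtain l c where u: "u = (l, c)" and l: "l < ?m" by auto
    define r n where "r = l div x" and "n = l mod x"
    have ln: "l = x * r + n" "n < x" "r < s"
      using x l by (simp_all add: r_def n_def less_mult_imp_div_less mult.commute)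
    have mem: "S r n \<in> ?U" "T r n \<in> ?U" if "r < s" "n < x" for r n
      using that unfolding cs_def by (auto intro!: bexI[of _ r])
    consider "c = (n = 0)" | "c" "n \<noteq> 0" | "\<not> c" "n = 0" by auto
    then show "u \<in> ?U"
    proof cases
      case 1
      then have "u = S r n" using ln u by (simp add: S_def)
      then show ?thesis using ln mem by simp
    next
      case 2
      then have "u = T r (n - 1)" using ln u l by (simp add: T_def)
      moreover have "n - 1 < x" using ln by simp
      ultimately show ?thesis using ln mem by simp
    next
      case 3
      \<comment> \<open>The copy \<open>False\<close> of a bottleneck belongs to the block before
        it, cyclically.\<close>
      define r' where "r' = (if r = 0 then s - 1 else r - 1)"
      have "Suc (x - 1) = x" using x by simp
      moreover have "x * r' + x = (if r = 0 then ?m else l)"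
        using s 3 ln by (cases r; cases s) (simp_all add: r'_def)
      ultimately have "T r' (x - 1) = ((if r = 0 then ?m else l) mod ?m, False)"
        by (simp only: T_def) simp
      then have "u = T r' (x - 1)" using 3 u l ln(1) by (cases "r = 0") simp_all
      moreover have "r' < s" "x - 1 < x" using ln x by (auto simp: r'_def)
      ultimately show ?thesis using mem by simp
    qed
  qed
  ultimately have "tiles (2 * x) ({..<?m} \<times> UNIV) ?P cs"
    using x by (intro tilesI) (force simp: cs_def card_cartesian_product)+
  then show ?thesis ..
qed

text \<open>Exactly one of two consecutive layers is even, also across the wrap-around as
  \<open>x\<close> is even, so the flip negates \<open>c = c'\<close>. The layers divisible by
  \<open>x\<close> are even, so it negates the two bottleneck conditions as well.\<close>

lemma tiles_doubled_cycle_flipped: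
  assumes x: "2 \<le> x" "even x" and s: "0 < s"
  shows "\<exists>cs. tiles (2 * x) ({..<x * s} \<times> UNIV) (dbl_adj (x * s) (\<lambda>l c c'. \<not> dbl_rule x l c c')) cs"
proof -
  let ?m = "x * s"
  define g where "g u = (fst u, snd u \<noteq> even (fst u))" for u :: "nat \<times> bool"
  obtain cs where cs: "tiles (2 * x) ({..<?m} \<times> UNIV) (dbl_adj ?m (dbl_rule x)) cs"
    using tiles_doubled_cycle[OF x(1) s] by blast
  have gg: "g (g u) = u" for u by (cases u) (auto simp: g_def)
  then have "inj g" by (rule inj_on_inverseI)
  have im: "g ` ({..<?m} \<times> UNIV) = {..<?m} \<times> UNIV"
  proof
    show "g ` ({..<?m} \<times> UNIV) \<subseteq> {..<?m} \<times> UNIV" by (auto simp: g_def)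
    then have "g ` g ` ({..<?m} \<times> UNIV) \<subseteq> g ` ({..<?m} \<times> UNIV)" by (rule image_mono)
    then show "{..<?m} \<times> UNIV \<subseteq> g ` ({..<?m} \<times> UNIV)" by (simp add: image_image gg)
  qed
  have par: "even (Suc l mod ?m) \<longleftrightarrow> odd l" for l
    using x(2) by (simp add: dvd_mod_iff)
  have step: "\<not> dbl_rule x l (c \<noteq> even l) (c' \<noteq> odd l)" if "dbl_rule x l c c'" for l c c'
  proof -
    have "x dvd l \<Longrightarrow> even l" "x dvd Suc l \<Longrightarrow> odd l" using x(2) by (auto dest: dvd_trans)
    then show ?thesis using that
      by (cases "x dvd l"; cases "x dvd Suc l"; cases "even l") (simp_all add: dbl_rule_def)
  qed
  have "dbl_adj ?m (\<lambda>l c c'. \<not> dbl_rule x l c c') (g u) (g w)"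
    if adj: "dbl_adj ?m (dbl_rule x) u w" for u w
  proof -
    obtain l c l' c' where u: "u = (l, c)" "w = (l', c')" by (metis surj_pair)
    consider "l' = Suc l mod ?m" "dbl_rule x l c c'" | "l = Suc l' mod ?m" "dbl_rule x l' c' c"
      using adj by (auto simp: dbl_adj_def u)
    then show ?thesis
    proof cases
      case 1
      then have "even l' = odd l" using par by simp
      then show ?thesis using 1 step[OF 1(2)] by (simp add: dbl_adj_def g_def u)
    next
      case 2
      then have "even l = odd l'" using par by simp
      then show ?thesis using 2 step[OF 2(2)] by (simp add: dbl_adj_def g_def u)
    qed
  qed
  then have "tiles (2 * x) (g ` ({..<?m} \<times> UNIV)) (dbl_adj ?m (\<lambda>l c c'. \<not> dbl_rule x l c c')) (map (map g) cs)"
    by (intro tiles_map[OF cs] inj_on_subset[OF \<open>inj g\<close>]) simp_all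
  then show ?thesis unfolding im by blast
qed

text \<open>The one-factorization of the complete graph on \<open>{..<2 k}\<close> by sums modulo \<open>2 k - 1\<close>, the
  vertex \<open>0\<close> playing the role of the point at infinity.\<close>

definition gk_sum :: "nat \<Rightarrow> nat \<Rightarrow> nat \<Rightarrow> nat" where
  "gk_sum k p q = (if p = 0 then 2 * q else if q = 0 then 2 * p else p + q) mod (2 * k - 1)"

lemma gk_sum_commute: "gk_sum k p q = gk_sum k q p"
  by (simp add: gk_sum_def add.commute)

text \<open>The Walecki zigzag: a Hamiltonian cycle made of the factors \<open>2 i + 1\<close> and \<open>2 i + 2\<close>.\<close>

definition gk_cycle :: "nat \<Rightarrow> nat \<Rightarrow> nat \<Rightarrow> nat" where
  "gk_cycle k i l =
     (if l = 0 then 0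
      else Suc ((i + k - 1 + (if even l then l div 2 else 2 * k - 1 - l div 2)) mod (2 * k - 1)))"

text \<open>The offsets at even positions \<open>l > 0\<close> fill \<open>1\<close> to
  \<open>k - 1\<close>, those at odd positions \<open>k\<close> to \<open>2 * k - 1\<close>: every
  residue once.\<close>

lemma gk_cycle_inj: "inj_on (gk_cycle k i) {..<2 * k}"
proof (rule inj_onI)
  fix l l' assume l: "l \<in> {..<2 * k}" "l' \<in> {..<2 * k}" and eq: "gk_cycle k i l = gk_cycle k i l'"
  define g where "g l = (if even l then l div 2 else 2 * k - 1 - l div 2)" for l
  have g: "1 \<le> g l" "g l \<le> 2 * k - 1" if "0 < l" "l < 2 * k" for l
    using that by (auto simp: g_def elim!: evenE oddE)
  have ginj: "l = l'" if "g l = g l'" "l < 2 * k" "l' < 2 * k" for l l'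
    using that by (auto simp: g_def elim!: evenE oddE split: if_splits)
  have mod: "a = b" if "(e + a) mod N = (e + b) mod N" "1 \<le> a" "b \<le> N" "a \<le> b" for a b e N :: nat
  proof -
    have "N dvd b - a" using that by (metis add_diff_cancel_left mod_eq_dvd_iff_nat nat_add_left_cancel_le)
    moreover have "b - a < N" using that by simp
    ultimately show ?thesis using that(4) by (auto dest: dvd_imp_le)
  qed
  show "l = l'"
  proof (cases "l = 0 \<or> l' = 0")
    case True then show ?thesis using eq by (auto simp: gk_cycle_def split: if_splits)
  next
    case False
    then have "(i + k - 1 + g l) mod (2 * k - 1) = (i + k - 1 + g l') mod (2 * k - 1)"
      using eq by (simp add: gk_cycle_def g_def)
    then have "g l = g l'"
      using mod[of "i + k - 1" "g l" "2 * k - 1" "g l'"] mod[of "i + k - 1" "g l'" "2 * k - 1" "g l"]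
        g[of l] g[of l'] l False by fastforce
    then show ?thesis using ginj l by simp
  qed
qed

lemma gk_cycle_image:
  assumes "0 < k" shows "gk_cycle k i ` {..<2 * k} = {..<2 * k}"
proof (rule endo_inj_surj)
  have "m mod (2 * k - 1) < 2 * k - 1" for m using assms by simp
  then show "gk_cycle k i ` {..<2 * k} \<subseteq> {..<2 * k}"
    using assms by (auto simp: gk_cycle_def less_diff_conv)
qed (use gk_cycle_inj in auto)

text \<open>The shift \<open>i + k - 1\<close> is chosen so that its double plus \<open>2\<close> is
  \<open>2 * i + 1\<close> modulo \<open>2 * k - 1\<close>. The offsets of positions
  \<open>2 * j\<close> and \<open>2 * j + 1\<close> cancel, those of \<open>2 * j + 1\<close> and
  \<open>2 * j + 2\<close> add up to one; at the vertex \<open>0\<close> the neighbour is doubled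
  instead.\<close>

lemma gk_sum_gk_cycle:
  assumes i: "i + 2 \<le> k" and l: "l < 2 * k"
  shows "gk_sum k (gk_cycle k i l) (gk_cycle k i (Suc l mod (2 * k))) = (if even l then 2 * i + 1 else 2 * i + 2)"
proof -
  define N where "N = 2 * k - 1"
  define e where "e = i + k - 1"
  have e: "2 * e + 2 = 2 * i + 1 + N" and N: "2 * i + 2 < N" "N + 1 = 2 * k" using i by (auto simp: e_def N_def)
  have gs: "gk_sum k p q = (if p = 0 then 2 * q else if q = 0 then 2 * p else p + q) mod N" for p q
    by (simp add: gk_sum_def N_def)
  have zero: "gk_cycle k i 0 = 0" by (simp add: gk_cycle_def)
  have even: "gk_cycle k i (2 * j) = Suc ((e + j) mod N)" if "0 < j" for j
    using that by (simp add: gk_cycle_def e_def N_def)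
  have odd: "gk_cycle k i (Suc (2 * j)) = Suc ((e + (N - j)) mod N)" for j
    by (simp add: gk_cycle_def e_def N_def)
  have sum: "(Suc (a mod N) + Suc (b mod N)) mod N = c" if "a + b + 2 = c + N * d" "c < N" for a b c d
  proof -
    have "(Suc (a mod N) + Suc (b mod N)) mod N = (a + b + 2) mod N"
      by (metis (no_types, lifting) add_2_eq_Suc' add_Suc add_Suc_right mod_Suc_eq mod_add_eq)
    then show ?thesis using that by simp
  qed
  have dbl: "(2 * Suc (a mod N)) mod N = c" if "2 * a + 2 = c + N * d" "c < N" for a c d
    using sum[of a a c d] that by (simp add: mult_2)
  show ?thesis
  proof (cases "even l")
    case True
    then obtain j where j: "l = 2 * j" by blast
    have "Suc l mod (2 * k) = Suc l" using l j by simp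
    moreover have "gk_sum k (gk_cycle k i l) (gk_cycle k i (Suc l)) = 2 * i + 1"
    proof (cases "j = 0")
      case True
      have "2 * (e + (N - j)) + 2 = (2 * i + 1) + N * 3" using e True by simp
      from dbl[OF this] show ?thesis using N True j zero odd[of 0] by (simp add: gs)
    next
      case False
      have "(e + j) + (e + (N - j)) + 2 = (2 * i + 1) + N * 2" using e j l N by simp
      from sum[OF this] show ?thesis using N False j even[of j] odd[of j] by (simp add: gs)
    qed
    ultimately show ?thesis using True by simp
  next
    case False
    then obtain j where j: "l = Suc (2 * j)" by (metis oddE Suc_eq_plus1)
    have "gk_sum k (gk_cycle k i l) (gk_cycle k i (Suc l mod (2 * k))) = 2 * i + 2"
    proof (cases "Suc l = 2 * k")
      case True
      then have "N - j = k" using j N by simp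
      then have "2 * (e + (N - j)) + 2 = (2 * i + 2) + N * 2" using e N by simp
      from dbl[OF this] show ?thesis using N True j zero odd[of j] by (simp add: gs)
    next
      case False
      have "(e + (N - j)) + (e + Suc j) + 2 = (2 * i + 2) + N * 2" using e j l N by simp
      from sum[OF this] show ?thesis using N False l j even[of "Suc j"] odd[of j] by (simp add: gs)
    qed
    then show ?thesis using False by simp
  qed
qed

section \<open>Squares\<close>

text \<open>One copy of a fixed tiling for each \<open>m < n\<close>; covering and counting stand in
  for the injectivity of \<open>g\<close>.\<close>

lemma tiles_blocks:
  assumes t: "tiles L Y P ks" and L: "0 < L"
    and P: "\<And>m y y'. m < n \<Longrightarrow> y \<in> Y \<Longrightarrow> y' \<in> Y \<Longrightarrow> P y y' \<Longrightarrow> Q (g (m, y)) (g (m, y'))"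
    and V: "V \<subseteq> g ` ({..<n} \<times> Y)" and card: "card V = n * card Y"
  shows "\<exists>cs. tiles L V Q cs"
proof -
  define cs where "cs = concat (map (\<lambda>m. map (map (\<lambda>y. g (m, y))) ks) [0..<n])"
  have Y: "(\<Union>xs \<in> set ks. set xs) = Y" and lenY: "length ks * L = card Y"
    using t by (simp_all add: tiles_def)
  have len: "length cs = n * length ks"
    unfolding cs_def by (induction n) simp_all
  have lc: "length cs * L = card V" using len lenY card by (simp add: mult.assoc)
  have elem: "length xs = L \<and> successively Q (xs @ [hd xs])" if "xs \<in> set cs" for xs
  proof -
    obtain m ys where m: "m < n" "ys \<in> set ks" "xs = map (\<lambda>y. g (m, y)) ys"
      using \<open>xs \<in> set cs\<close> by (auto simp: cs_def)
    have ys: "length ys = L" "\<And>i. i < L \<Longrightarrow> P (ys ! i) (ys ! (Suc i mod L))"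
      using t m(2) by (auto simp: tiles_def)
    have Yys: "ys ! i \<in> Y" if "i < L" for i using Y m(2) ys(1) that nth_mem by blast
    have "Q ((xs @ [hd xs]) ! i) ((xs @ [hd xs]) ! Suc i)" if i: "i < L" for i
    proof -
      have "Suc i mod L < L" using i by simp
      moreover have "(xs @ [hd xs]) ! i = g (m, ys ! i)" using m(3) ys(1) i by (simp add: nth_append)
      moreover have "(xs @ [hd xs]) ! Suc i = g (m, ys ! (Suc i mod L))"
        using m(3) ys(1) i by (cases "Suc i = L"; cases ys) (auto simp: nth_append)
      ultimately show ?thesis using P[OF m(1) Yys Yys ys(2)] i by simp
    qed
    then show ?thesis using m(3) ys(1) by (simp add: successively_conv_nth)
  qed
  have "V \<subseteq> (\<Union>xs \<in> set cs. set xs)"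
  proof
    fix v assume "v \<in> V"
    then obtain m y where "m < n" "y \<in> Y" "v = g (m, y)" using V by auto
    moreover from this obtain ys where "ys \<in> set ks" "y \<in> set ys" using Y by blast
    ultimately show "v \<in> (\<Union>xs \<in> set cs. set xs)" by (force simp: cs_def)
  qed
  then have "tiles L V Q cs" using elem L lc by (intro tilesI) auto
  then show ?thesis ..
qed

text \<open>A decomposition of the complete graph on twelve points, viewed as the doubled complete graph on
  six points: \<open>0\<close> labels a factor into hexagons, \<open>1\<close> to \<open>4\<close> factors into squares, and \<open>5\<close> a
  1-factor. The squares labelled \<open>1\<close>, \<open>2\<close>, \<open>3\<close> double the 1-factors of the prism complementary to a
  hexagon.\<close>

definition lab12 :: "nat \<Rightarrow> nat \<Rightarrow> nat" where
  "lab12 y y' = (let a = min (y div 2) (y' div 2); b = max (y div 2) (y' div 2) in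
     if a = b then 4
     else if b = Suc a \<or> a = 0 \<and> b = 5 then
       if y mod 2 = y' mod 2 then 0 else if even a \<and> b = Suc a then 4 else 5
     else if (a, b) \<in> {(0, 3), (2, 4), (1, 5)} then 1
     else if (a, b) \<in> {(1, 4), (0, 2), (3, 5)} then 2
     else 3)"

lemma lab12_commute: "lab12 y y' = lab12 y' y"
  unfolding lab12_def by (simp only: min.commute max.commute eq_commute)

lemma tiles_lab12:
  "tiles 6 {..<12} (\<lambda>y y'. lab12 y y' = 0) [[0, 2, 4, 6, 8, 10], [1, 3, 5, 7, 9, 11]]"
  "tiles 4 {..<12} (\<lambda>y y'. lab12 y y' = 1) [[0, 6, 1, 7], [4, 8, 5, 9], [2, 10, 3, 11]]"
  "tiles 4 {..<12} (\<lambda>y y'. lab12 y y' = 2) [[2, 8, 3, 9], [0, 4, 1, 5], [6, 10, 7, 11]]"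
  "tiles 4 {..<12} (\<lambda>y y'. lab12 y y' = 3) [[4, 10, 5, 11], [0, 8, 1, 9], [2, 6, 3, 7]]"
  "tiles 4 {..<12} (\<lambda>y y'. lab12 y y' = 4) [[0, 1, 2, 3], [4, 5, 6, 7], [8, 9, 10, 11]]"
  "tiles 2 {..<12} (\<lambda>y y'. lab12 y y' = 5) [[2, 5], [3, 4], [6, 9], [7, 8], [10, 1], [11, 0]]"
  by code_simp+

text \<open>The complete bipartite graph between two groups of six is the doubled one between two
  triples. Sums modulo 3 factor the latter, and a doubled edge is a square.\<close>

definition lab66 :: "nat \<Rightarrow> nat \<Rightarrow> nat \<Rightarrow> bool" where
  "lab66 c y y' \<longleftrightarrow> (y < 6 \<longleftrightarrow> 6 \<le> y') \<and> (y div 2 + y' div 2) mod 3 = c"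

lemma tiles_lab66:
  assumes "c < 3" shows "\<exists>ks. tiles 4 {..<12} (lab66 c) ks"
proof -
  have "tiles 4 {..<12} (lab66 0) [[0, 6, 1, 7], [2, 10, 3, 11], [4, 8, 5, 9]]"
    "tiles 4 {..<12} (lab66 1) [[0, 8, 1, 9], [2, 6, 3, 7], [4, 10, 5, 11]]"
    "tiles 4 {..<12} (lab66 2) [[0, 10, 1, 11], [2, 8, 3, 9], [4, 6, 5, 7]]"
    by code_simp+
  moreover have "c = 0 \<or> c = 1 \<or> c = 2" using assms by auto
  ultimately show ?thesis by blast
qed

text \<open>For squares the groups of six points indexed by \<open>{..<2 t}\<close> are paired by the factor of sum \<open>0\<close>
  into blocks of twelve, and the groups paired by any other factor span three factors into squares.\<close>

definition block_pos :: "nat \<Rightarrow> nat \<times> nat \<Rightarrow> nat" where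
  "block_pos t u = (if fst u < t then snd u else snd u + 6)"

text \<open>Labels \<open>1\<close> to \<open>4\<close> come from the blocks of twelve, and each sum
  \<open>s\<close> from \<open>1\<close> to \<open>2 * t - 2\<close> contributes three more, up to
  \<open>6 * t - 2\<close>. The 1-factor needs the last label, so \<open>5\<close> is renamed to
  \<open>6 * t - 1\<close>.\<close>

definition square_lab :: "nat \<Rightarrow> nat \<times> nat \<Rightarrow> nat \<times> nat \<Rightarrow> nat" where
  "square_lab t u w = (let s = gk_sum t (fst u) (fst w); n = lab12 (block_pos t u) (block_pos t w) in
     if fst u = fst w \<or> s = 0 then if n = 5 then 6 * t - 1 else n
     else 5 + 3 * (s - 1) + (snd u div 2 + snd w div 2) mod 3)"

lemma square_lab_commute: "square_lab t u w = square_lab t w u"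
proof -
  have e: "fst u = fst w \<longleftrightarrow> fst w = fst u" by auto
  show ?thesis
    by (simp only: square_lab_def gk_sum_commute[of t "fst u" "fst w"] e add.commute[of "snd u div 2"]
        lab12_commute[of "block_pos t u"])
qed

lemma HWP_solution_squares:
  assumes t: "0 < t"
  shows "\<exists>F G. HWP_solution (12 * t) 6 4 1 (6 * t - 2) F G"
proof -
  let ?V = "{..<2 * t} \<times> {..<6 :: nat}"
  define g where "g u = (if snd u < 6 then u else (2 * t - 1 - fst u, snd u - 6))" for u :: "nat \<times> nat"
  have cover: "?V \<subseteq> g ` ({..<t} \<times> {..<12})"
  proof
    fix u assume "u \<in> ?V"
    then obtain p z where u: "u = (p, z)" "p < 2 * t" "z < 6" by auto
    show "u \<in> g ` ({..<t} \<times> {..<12})"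
    proof (cases "p < t")
      case True then show ?thesis using u by (intro image_eqI[of _ _ "(p, z)"]) (auto simp: g_def)
    next
      case False
      then show ?thesis using u by (intro image_eqI[of _ _ "(2 * t - 1 - p, z + 6)"]) (auto simp: g_def)
    qed
  qed
  have inner: "square_lab t (g (m, y)) (g (m, y')) = (if lab12 y y' = 5 then 6 * t - 1 else lab12 y y')"
    if m: "m < t" "y \<in> {..<12}" "y' \<in> {..<12}" for m y y'
  proof -
    have pos: "block_pos t (g (m, y)) = y" if "y < 12" for y
      using m(1) that by (auto simp: block_pos_def g_def)
    have sum: "gk_sum t m (2 * t - 1 - m) = 0" "gk_sum t (2 * t - 1 - m) m = 0"
      using m(1) by (auto simp: gk_sum_def)
    have "fst (g (m, y)) = fst (g (m, y')) \<or> gk_sum t (fst (g (m, y))) (fst (g (m, y'))) = 0"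
      using sum by (auto simp: g_def)
    then show ?thesis using pos m by (auto simp: square_lab_def Let_def)
  qed
  have block: "\<exists>cs. tiles L ?V (\<lambda>u w. square_lab t u w = n') cs"
    if "tiles L {..<12} (\<lambda>y y'. lab12 y y' = n) ks" "0 < L" "n' = (if n = 5 then 6 * t - 1 else n)" for L n n' ks
    by (rule tiles_blocks[OF that(1,2), where g = g and n = t])
       (use that(3) inner cover in \<open>auto simp: card_cartesian_product\<close>)
  have "\<exists>F G. HWP_solution (card ?V) 6 4 1 (6 * t - 2) F G"
  proof (rule HWP_solutionI[where lab = "square_lab t"])
    show "card ?V = 2 * (1 + (6 * t - 2)) + 2" using t by (simp add: card_cartesian_product)
    show "square_lab t u w = square_lab t w u" for u w by (rule square_lab_commute)
    show "\<exists>cs. tiles 6 ?V (\<lambda>u w. square_lab t u w = i) cs" if "i < 1" for i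
      using block[OF tiles_lab12(1)] that by simp
    show "\<exists>cs. tiles 2 ?V (\<lambda>u w. square_lab t u w = 1 + (6 * t - 2)) cs"
    proof -
      have "1 + (6 * t - 2) = 6 * t - 1" using t by simp
      then show ?thesis using block[OF tiles_lab12(6)] by simp
    qed
    show "\<exists>cs. tiles 4 ?V (\<lambda>u w. square_lab t u w = i) cs" if i: "1 \<le> i" "i < 1 + (6 * t - 2)" for i
    proof (cases "i < 5")
      case True
      then consider "i = 1" | "i = 2" | "i = 3" | "i = 4" using i by linarith
      then show ?thesis
        using block[OF tiles_lab12(2)] block[OF tiles_lab12(3)] block[OF tiles_lab12(4)] block[OF tiles_lab12(5)]
        by cases simp_all
    next
      case False
      define s c where "s = Suc ((i - 5) div 3)" and "c = (i - 5) mod 3"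
      \<comment> \<open>The factor of sum \<open>s\<close> is read off as every second edge of the
        zigzag \<open>gk_cycle t n\<close>, namely those starting at positions of parity
        \<open>e\<close>.\<close>
      define n e where "n = (s - 1) div 2" and "e = (s - 1) mod 2"
      have ic: "i = 5 + 3 * (s - 1) + c" "c < 3" using False by (simp_all add: s_def c_def)
      have s: "s = 2 * n + 1 + e" "e < 2" by (simp_all add: n_def e_def s_def)
      have n: "n + 2 \<le> t" using ic s i by linarith
      let ?w = "gk_cycle t n"
      define f where "f u = (let l = 2 * fst u + e in
        if snd u < 6 then (?w l, snd u) else (?w (Suc l mod (2 * t)), snd u - 6))" for u :: "nat \<times> nat"
      obtain ks where ks: "tiles 4 {..<12} (lab66 c) ks" using tiles_lab66[OF ic(2)] by blast
      have lab: "square_lab t (?w l, y) (?w (Suc l mod (2 * t)), y' - 6) = i"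
        if "l = 2 * m + e" "m < t" "y < 6" "6 \<le> y'" "lab66 c y y'" for l m y y'
      proof -
        have l: "l < 2 * t" using that s by auto
        have "l \<noteq> Suc l mod (2 * t)" using Suc_mod_eq_self[OF l] n by fastforce
        then have "?w l \<noteq> ?w (Suc l mod (2 * t))"
          using inj_on_eq_iff[OF gk_cycle_inj, of l t "Suc l mod (2 * t)" n] l by simp
        moreover have "gk_sum t (?w l) (?w (Suc l mod (2 * t))) = s"
          using gk_sum_gk_cycle[OF n l] that(1) s by (cases "e = 0") auto
        moreover have "(y div 2 + (y' - 6) div 2) mod 3 = c"
        proof -
          have "y' div 2 = (y' - 6) div 2 + 3" using that(4) by presburger
          then show ?thesis using that(5) by (simp add: lab66_def flip: add.assoc)
        qed
        ultimately show ?thesis using ic s by (simp add: square_lab_def)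
      qed
      show ?thesis
      proof (rule tiles_blocks[OF ks, where g = f and n = t])
        show "square_lab t (f (m, y)) (f (m, y')) = i"
          if "m < t" "lab66 c y y'" for m y y'
        proof (cases "y < 6")
          case True
          then have "6 \<le> y'" using that by (simp add: lab66_def)
          then show ?thesis using lab[OF refl that(1) True _ that(2)] True by (simp add: f_def Let_def)
        next
          case False
          then have "y' < 6" "lab66 c y' y" using that by (auto simp: lab66_def add.commute)
          then show ?thesis using lab[OF refl that(1), of y' y] False
            by (subst square_lab_commute) (simp add: f_def Let_def)
        qed
        show "?V \<subseteq> f ` ({..<t} \<times> {..<12})"
        proof
          fix u assume "u \<in> ?V"
          then obtain p z where u: "u = (p, z)" "p < 2 * t" "z < 6" by auto
          then obtain l where l: "l < 2 * t" "p = ?w l" using gk_cycle_image[OF t, of n] by (metis imageE lessThan_iff)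
          show "u \<in> f ` ({..<t} \<times> {..<12})"
          proof (cases "l mod 2 = e")
            case True
            then have "l = 2 * (l div 2) + e" by presburger
            then show ?thesis using u l
              by (intro image_eqI[of _ _ "(l div 2, z)"]) (auto simp: f_def Let_def)
          next
            case False
            \<comment> \<open>A position of the other parity is the second end of its edge, which
              starts at the cyclic predecessor.\<close>
            define l' where "l' = (if l = 0 then 2 * t - 1 else l - 1)"
            have "l' < 2 * t" "Suc l' mod (2 * t) = l" using l t by (auto simp: l'_def)
            moreover have "l' = 2 * (l' div 2) + e" using False s(2) t unfolding l'_def by presburger
            ultimately show ?thesis using u l
              by (intro image_eqI[of _ _ "(l' div 2, z + 6)"]) (auto simp: f_def Let_def)
          qed
        qed
      qed (simp_all add: card_cartesian_product)
    qed
  qed auto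
  then show ?thesis by (simp add: card_cartesian_product)
qed

section \<open>The doubled ladder\<close>

text \<open>\<open>dbl_rule\<close> is oriented along the cycle, but labels must be symmetric; hence
  the unordered pair and the quantifier over positions.\<close>

definition dbl_lab :: "nat \<Rightarrow> nat \<Rightarrow> nat \<Rightarrow> nat \<times> bool \<Rightarrow> nat \<times> bool \<Rightarrow> bool" where
  "dbl_lab k x i u w \<longleftrightarrow> (\<exists>l < 2 * k. \<exists>c c'. dbl_rule x l c c' \<and>
     {u, w} = {(gk_cycle k i l, c), (gk_cycle k i (Suc l mod (2 * k)), c')})"

text \<open>The labels \<open>2 i + 1\<close> and \<open>2 i + 2\<close> are the two halves of the doubled Hamiltonian cycle \<open>i\<close>;
  the doubled factors of sum \<open>0\<close>, \<open>1\<close>, \<open>2\<close>, and the pairs of copies, are labelled by \<open>f\<close>.\<close>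

definition full_lab ::
    "nat \<Rightarrow> nat \<Rightarrow> (nat \<times> bool \<Rightarrow> nat \<times> bool \<Rightarrow> nat) \<Rightarrow> nat \<times> bool \<Rightarrow> nat \<times> bool \<Rightarrow> nat" where
  "full_lab k x f u w = (let s = gk_sum k (fst u) (fst w); i = (s - 1) div 2 in
     if fst u = fst w \<or> s \<le> 2 then f u w else 2 * i + (if dbl_lab k x i u w then 1 else 2))"

lemma full_lab_commute:
  assumes "\<And>u w. f u w = f w u"
  shows "full_lab k x f u w = full_lab k x f w u"
proof -
  have d: "dbl_lab k x i u w = dbl_lab k x i w u" for i by (simp only: dbl_lab_def insert_commute)
  have e: "fst u = fst w \<longleftrightarrow> fst w = fst u" by auto
  show ?thesis
    by (simp only: full_lab_def Let_def gk_sum_commute[of k "fst u" "fst w"] assms[of u w] d e)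
qed

text \<open>The zigzag is injective and longer than two, so an edge determines its position and
  \<open>dbl_lab\<close> collapses to \<open>dbl_rule\<close>. The bound \<open>1 \<le> i\<close>
  keeps the sum above \<open>2\<close>, outside the ladder.\<close>

lemma full_lab_gk_cycle:
  assumes i: "1 \<le> i" "i + 2 \<le> k" and l: "l < 2 * k"
  shows "full_lab k x f (gk_cycle k i l, c) (gk_cycle k i (Suc l mod (2 * k)), c')
           = 2 * i + (if dbl_rule x l c c' then 1 else 2)"
proof -
  let ?g = "gk_cycle k i" and ?l = "Suc l mod (2 * k)"
  have l': "?l < 2 * k" using l by simp
  have inj: "?g a = ?g b \<longleftrightarrow> a = b" if "a < 2 * k" "b < 2 * k" for a b
    using inj_on_eq_iff[OF gk_cycle_inj] that by simp
  have "l \<noteq> ?l" using Suc_mod_eq_self[OF l] i by fastforce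
  then have ne: "?g l \<noteq> ?g ?l" using inj l l' by simp
  have "dbl_lab k x i (?g l, c) (?g ?l, c') \<longleftrightarrow> dbl_rule x l c c'"
  proof
    assume "dbl_lab k x i (?g l, c) (?g ?l, c')"
    then obtain m d d' where m: "m < 2 * k" "dbl_rule x m d d'"
      and eq: "{(?g l, c), (?g ?l, c')} = {(?g m, d), (?g (Suc m mod (2 * k)), d')}"
      unfolding dbl_lab_def by blast
    have m': "Suc m mod (2 * k) < 2 * k" using m by simp
    from eq have "?g l = ?g m \<and> c = d \<and> c' = d' \<or> ?g l = ?g (Suc m mod (2 * k)) \<and> ?g ?l = ?g m"
      unfolding doubleton_eq_iff by auto
    then have "l = m \<and> c = d \<and> c' = d' \<or> l = Suc m mod (2 * k) \<and> ?l = m"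
      using inj[OF l m(1)] inj[OF l m'] inj[OF l' m(1)] by blast
    then show "dbl_rule x l c c'" using m Suc_mod_swap[OF l m(1)] i by auto
  next
    assume "dbl_rule x l c c'"
    then show "dbl_lab k x i (?g l, c) (?g ?l, c')" using l unfolding dbl_lab_def by blast
  qed
  then show ?thesis using ne gk_sum_gk_cycle[OF i(2) l] i(1) by (simp add: full_lab_def Let_def)
qed

lemma tiles_doubled_gk_cycle:
  assumes i: "1 \<le> i" "i + 2 \<le> k" and x: "2 \<le> x" "even x" "x dvd 2 * k"
    and j: "j = 2 * i + 1 \<or> j = 2 * i + 2"
    and sym: "\<And>u w. f u w = f w u"
  shows "\<exists>cs. tiles (2 * x) ({..<2 * k} \<times> UNIV) (\<lambda>u w. full_lab k x f u w = j) cs"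
proof -
  let ?V = "{..<2 * k} \<times> (UNIV :: bool set)"
  define R where "R l c c' \<longleftrightarrow> (dbl_rule x l c c' \<longleftrightarrow> j = 2 * i + 1)" for l c c'
  define g where "g u = (gk_cycle k i (fst u), snd u)" for u :: "nat \<times> bool"
  obtain s where s: "2 * k = x * s" using x(3) by blast
  then have "0 < s" using i by (cases s) auto
  have "\<exists>cs. tiles (2 * x) ?V (dbl_adj (2 * k) R) cs"
  proof (cases "j = 2 * i + 1")
    case True
    then have "R = dbl_rule x" by (auto simp: R_def fun_eq_iff)
    then show ?thesis using tiles_doubled_cycle[OF x(1) \<open>0 < s\<close>] s by simp
  next
    case False
    then have "R = (\<lambda>l c c'. \<not> dbl_rule x l c c')" by (auto simp: R_def fun_eq_iff)
    then show ?thesis using tiles_doubled_cycle_flipped[OF x(1,2) \<open>0 < s\<close>] s by simp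
  qed
  then obtain cs where cs: "tiles (2 * x) ?V (dbl_adj (2 * k) R) cs" ..
  have "inj_on g ?V"
    using inj_on_eq_iff[OF gk_cycle_inj, of _ k] by (auto simp: g_def inj_on_def)
  moreover have "full_lab k x f (g u) (g w) = j"
    if u: "u \<in> ?V" "w \<in> ?V" and adj: "dbl_adj (2 * k) R u w" for u w
  proof -
    have *: "full_lab k x f (g u) (g w) = j"
      if "u \<in> ?V" "fst w = Suc (fst u) mod (2 * k)" "R (fst u) (snd u) (snd w)" for u w
      using full_lab_gk_cycle[OF i, of "fst u" x f "snd u" "snd w"] that j
      by (auto simp: g_def R_def)
    from adj consider "fst w = Suc (fst u) mod (2 * k)" "R (fst u) (snd u) (snd w)"
      | "fst u = Suc (fst w) mod (2 * k)" "R (fst w) (snd w) (snd u)"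
      unfolding dbl_adj_def by blast
    then show ?thesis
    proof cases
      case 1 then show ?thesis by (rule *[OF u(1)])
    next
      case 2 then show ?thesis by (subst full_lab_commute[OF sym]) (rule *[OF u(2)])
    qed
  qed
  ultimately have "tiles (2 * x) (g ` ?V) (\<lambda>u w. full_lab k x f u w = j) (map (map g) cs)"
    by (intro tiles_map[OF cs])
  moreover have "g ` ?V = ?V"
  proof -
    have "g ` ?V = gk_cycle k i ` {..<2 * k} \<times> UNIV" by (force simp: g_def)
    then show ?thesis using gk_cycle_image i by simp
  qed
  ultimately show ?thesis by auto
qed

text \<open>The factors of sum \<open>0\<close>, \<open>1\<close>, \<open>2\<close> form a ladder. Its doubled vertices are written (column,
  letter) with letters \<open>a, b, c, d = 0, 1, 2, 3\<close>: for \<open>1 \<le> j < k\<close> column \<open>j\<close> consists of the two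
  copies \<open>a, c\<close> of the vertex \<open>j\<close> and the two copies \<open>b, d\<close> of \<open>2 k - j\<close>; the ends are column \<open>0\<close>,
  the two copies \<open>c, d\<close> of the vertex \<open>0\<close>, and column \<open>k\<close>, the two copies \<open>a, c\<close> of \<open>k\<close>.\<close>

definition strip :: "nat \<Rightarrow> (nat \<times> nat) set" where
  "strip k = {1..<k} \<times> {..<4} \<union> {(0, 2), (0, 3), (k, 0), (k, 2)}"

definition to_strip :: "nat \<Rightarrow> nat \<times> bool \<Rightarrow> nat \<times> nat" where
  "to_strip k u = (let p = fst u; c = snd u in
     if p = 0 then (0, if c then 3 else 2)
     else if p \<le> k then (p, if c then 2 else 0)
     else (2 * k - p, if c then 3 else 1))"

definition of_strip :: "nat \<Rightarrow> nat \<times> nat \<Rightarrow> nat \<times> bool" where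
  "of_strip k u = (let j = fst u; z = snd u in
     if j = 0 then (0, z = 3) else if even z then (j, z = 2) else (2 * k - j, z = 3))"

text \<open>Inside a column lie the pairs of copies and the doubled rung of sum \<open>1\<close>.
  Between columns \<open>j\<close> and \<open>j + 1\<close>, sum \<open>0\<close> joins
  \<open>j\<close> to \<open>2 * k - j - 1\<close> and sum \<open>2\<close> joins
  \<open>2 * k - j\<close> to \<open>j + 1\<close>, hence letters of different parity. An end column
  doubles a single vertex, joined to the whole neighbouring column; the vertices \<open>0\<close>
  and \<open>k\<close> have sum \<open>1\<close>.\<close>

definition strip_adj :: "nat \<Rightarrow> nat \<times> nat \<Rightarrow> nat \<times> nat \<Rightarrow> bool" where
  "strip_adj k u w \<longleftrightarrow> fst u = fst w \<or>
     (fst w = Suc (fst u) \<or> fst u = Suc (fst w)) \<and>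
       (fst u \<in> {0, k} \<or> fst w \<in> {0, k} \<or> odd (snd u + snd w)) \<or>
     fst u = 0 \<and> fst w = k \<or> fst u = k \<and> fst w = 0"

text \<open>Label \<open>0\<close> is the factor into hexagons, \<open>1\<close> and \<open>2\<close> are the two factors into long cycles, and
  \<open>2 k - 1\<close> is the 1-factor. Away from the ends, the hexagons and the 1-factor have period three;
  exchanging the labels \<open>1\<close> and \<open>2\<close> inside the columns that \<open>h\<close> divides cuts the long cycles there.\<close>

definition strip_lab_ordered :: "nat \<Rightarrow> nat \<Rightarrow> nat \<times> nat \<Rightarrow> nat \<times> nat \<Rightarrow> nat" where
  "strip_lab_ordered k h u w = (let j = fst u; j' = fst w; e = (snd u, snd w) in
     if j = j' then
       if e = (1, 2) then 0
       else if e = (0, 3) then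
         if j = 1 then 2 else if j = k - 1 then 1 else if 3 dvd j then 0 else 2 * k - 1
       else if e = (0, 2) \<or> e = (1, 3) then
         if j = k - 1 then 2 * k - 1 else if h dvd j then 2 else 1
       else if j = 1 then 2 * k - 1 else if h dvd j then 1 else 2
     else if j = 0 \<and> j' = k then if e = (2, 0) \<or> e = (3, 2) then 2 * k - 1 else 0
     else if j = 0 then
       if e = (2, 1) \<or> e = (3, 0) then 1 else if e = (2, 3) \<or> e = (3, 3) then 0 else 2
     else if j' = k then
       if e = (0, 0) \<or> e = (0, 2) then 0 else if e = (1, 0) \<or> e = (3, 2) then 2 else 1
     else if e = (2, 1) \<or> e = (3, 0) then 1
     else if e = (3, 2) \<or> e = (1, 0) then 2
     else if e = (0, 3) \<or> j mod 3 = 1 \<or> e = (2, 3) \<and> j mod 3 = 0 \<or> e = (0, 1) \<and> j mod 3 = 2 then 0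
     else 2 * k - 1)"

definition strip_lab :: "nat \<Rightarrow> nat \<Rightarrow> nat \<times> nat \<Rightarrow> nat \<times> nat \<Rightarrow> nat" where
  "strip_lab k h u w =
     (if fst u < fst w \<or> fst u = fst w \<and> snd u \<le> snd w
      then strip_lab_ordered k h u w else strip_lab_ordered k h w u)"

text \<open>\<open>strip_lab\<close> is total on pairs, but \<open>full_lab\<close> reads it only on
  the ladder; the adjacency records that the pair lies there.\<close>

definition strip_edge :: "nat \<Rightarrow> nat \<Rightarrow> nat \<Rightarrow> nat \<times> nat \<Rightarrow> nat \<times> nat \<Rightarrow> bool" where
  "strip_edge k h n u w \<longleftrightarrow> strip_adj k u w \<and> strip_lab k h u w = n"

lemmas strip_edge_defs = strip_edge_def strip_adj_def strip_lab_def strip_lab_ordered_def Let_def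

lemma strip_lab_commute: "strip_lab k h u w = strip_lab k h w u"
  by (cases u; cases w) (auto simp: strip_lab_def)

lemma strip_adj_sym: "strip_adj k u w \<Longrightarrow> strip_adj k w u"
  by (auto simp: strip_adj_def add.commute)

lemma strip_edge_sym: "strip_edge k h n u w \<Longrightarrow> strip_edge k h n w u"
  using strip_adj_sym strip_lab_commute[of k h u w] by (simp add: strip_edge_def)

lemma letter_cases: "(z :: nat) < 4 \<Longrightarrow> z = 0 \<or> z = 1 \<or> z = 2 \<or> z = 3"
  by auto

lemma to_of_strip: "0 < k \<Longrightarrow> u \<in> strip k \<Longrightarrow> to_strip k (of_strip k u) = u"
  by (auto simp: strip_def to_strip_def of_strip_def Let_def dest!: letter_cases)

lemma of_strip_image:
  assumes "2 \<le> k" shows "of_strip k ` strip k = {..<2 * k} \<times> UNIV"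
proof (intro equalityI subsetI)
  fix u assume "u \<in> of_strip k ` strip k"
  then show "u \<in> {..<2 * k} \<times> UNIV"
    using assms by (auto simp: strip_def of_strip_def Let_def)
next
  fix u :: "nat \<times> bool" assume "u \<in> {..<2 * k} \<times> UNIV"
  then obtain p c where u: "u = (p, c)" "p < 2 * k" by auto
  have "to_strip k u \<in> strip k" "of_strip k (to_strip k u) = u"
    using u assms by (auto simp: strip_def of_strip_def to_strip_def Let_def)
  then show "u \<in> of_strip k ` strip k" by (metis imageI)
qed

lemma inj_on_of_strip: "0 < k \<Longrightarrow> inj_on (of_strip k) (strip k)"
  by (rule inj_on_inverseI) (rule to_of_strip)

lemma card_strip:
  assumes "2 \<le> k" shows "card (strip k) = 4 * k"
  using card_image[OF inj_on_of_strip[of k]] of_strip_image[OF assms] assms by (simp add: card_cartesian_product)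

text \<open>Ensures that ladder edges receive their strip label from \<open>full_lab\<close> and not
  a label of a doubled Hamiltonian cycle.\<close>

lemma gk_sum_strip:
  assumes k: "3 \<le> k" and u: "u \<in> strip k" and w: "w \<in> strip k" and adj: "strip_adj k u w"
  shows "fst (of_strip k u) = fst (of_strip k w) \<or> gk_sum k (fst (of_strip k u)) (fst (of_strip k w)) \<le> 2"
proof -
  define N where "N = 2 * k - 1"
  have N: "2 < N" "2 * k = N + 1" using k by (auto simp: N_def)
  have mod: "(N + 1) mod N = 1" "(N + 2) mod N = 2" "(2 * N) mod N = 0" "2 mod N = 2"
    using N(1) by (simp_all add: mod_Suc)
  have gs: "gk_sum k p q = (if p = 0 then 2 * q else if q = 0 then 2 * p else p + q) mod N" for p q
    by (simp add: gk_sum_def N_def)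
  have sum: "gk_sum k p q \<le> 2" if "0 < p" "0 < q" "p + q \<in> {2 * k - 1, 2 * k, 2 * k + 1}" for p q
  proof -
    have "p + q = N \<or> p + q = N + 1 \<or> p + q = N + 2" using that(3) N by auto
    then show ?thesis using that(1,2) mod by (elim disjE) (simp_all add: gs)
  qed
  have sum0: "gk_sum k 0 q \<le> 2" if "q \<in> {1, k, 2 * k - 1}" for q
  proof -
    have "2 * q = 2 \<or> 2 * q = N + 1 \<or> 2 * q = 2 * N" using that N by auto
    then show ?thesis using mod by (elim disjE) (simp_all add: gs)
  qed
  have main: "fst (of_strip k u) = fst (of_strip k w) \<or> gk_sum k (fst (of_strip k u)) (fst (of_strip k w)) \<le> 2"
    if u: "u \<in> strip k" and w: "w \<in> strip k" and adj: "strip_adj k u w" and le: "fst u \<le> fst w" for u w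
  proof -
    obtain j z j' z' where u': "u = (j, z)" and w': "w = (j', z')" by (metis surj_pair)
    have base0: "fst (of_strip k (0, z)) = 0" for z by (simp add: of_strip_def)
    have base: "fst (of_strip k (j, z)) = (if even z then j else 2 * k - j)" if "0 < j" for j z
      using that by (simp add: of_strip_def)
    have k0: "even z'" if "j' = k" using w that k by (auto simp: strip_def w')
    have jk: "j \<le> k" "j' \<le> k" using u w k by (auto simp: strip_def u' w')
    consider "j = 0" "j' = 0" | "0 < j" "j = j'" | "j = 0" "j' = 1" | "j = 0" "j' = k"
      | "0 < j" "j' = Suc j" "j' = k" | "0 < j" "j' = Suc j" "odd (z + z')"
      using adj le jk by (auto simp: strip_adj_def u' w')
    then show ?thesis
    proof cases
      case 1 then show ?thesis by (simp add: u' w' base0)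
    next
      case 2 then show ?thesis using jk by (auto simp: u' w' base intro!: sum)
    next
      case 3 then show ?thesis by (auto simp: u' w' base base0 intro!: sum0)
    next
      case 4 then show ?thesis using k0 k by (auto simp: u' w' base base0 intro!: sum0)
    next
      case 5
      have "gk_sum k (if even z then j else 2 * k - j) k \<le> 2" using 5 by (intro sum) auto
      moreover have "fst (of_strip k u) = (if even z then j else 2 * k - j)" "fst (of_strip k w) = k"
        using 5 k0 base[of j z] base[of j' z'] by (simp_all add: u' w')
      ultimately show ?thesis by simp
    next
      case 6 then show ?thesis using jk by (auto simp: u' w' base intro!: sum)
    qed
  qed
  show ?thesis
  proof (cases "fst u \<le> fst w")
    case True then show ?thesis using main u w adj by blast
  next
    case False
    then show ?thesis
      using main[OF w u strip_adj_sym[OF adj]] by (subst gk_sum_commute) auto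
  qed
qed

lemma tiles_full_lab:
  assumes k: "3 \<le> k" and t: "tiles L (strip k) (strip_edge k h n) cs"
  shows "\<exists>cs. tiles L ({..<2 * k} \<times> UNIV)
    (\<lambda>u w. full_lab k x (\<lambda>u w. strip_lab k h (to_strip k u) (to_strip k w)) u w = n) cs"
proof -
  have "full_lab k x (\<lambda>u w. strip_lab k h (to_strip k u) (to_strip k w)) (of_strip k u) (of_strip k w) = n"
    if "u \<in> strip k" "w \<in> strip k" "strip_edge k h n u w" for u w
    using gk_sum_strip[OF k that(1,2)] that
    k by (auto simp: full_lab_def Let_def strip_edge_def to_of_strip)
  then have "tiles L (of_strip k ` strip k)
      (\<lambda>u w. full_lab k x (\<lambda>u w. strip_lab k h (to_strip k u) (to_strip k w)) u w = n) (map (map (of_strip k)) cs)"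
    using k by (intro tiles_map[OF t] inj_on_of_strip) auto
  then show ?thesis using of_strip_image[of k] k by auto
qed

section \<open>Hexagons and the 1-factor on the ladder\<close>

lemma tiles_hexagons:
  assumes q: "2 \<le> q" and k: "k = 3 * q"
  shows "\<exists>cs. tiles 6 (strip k) (strip_edge k h 0) cs"
proof -
  \<comment> \<open>\<open>P b\<close> takes the columns \<open>3 * b + 1\<close> and
    \<open>3 * b + 2\<close> except \<open>(3 * b + 1, 3)\<close> and \<open>(3 * b + 2, 0)\<close>;
    \<open>Q b\<close> joins the whole column \<open>3 * b + 3\<close> to the omitted points on
    either side. The first and last omitted points, \<open>(1, 3)\<close> and
    \<open>(k - 1, 0)\<close>, go with both end columns into \<open>Z\<close>.\<close>
  define P where "P b = [(3 * b + 2, 3), (3 * b + 1, 0), (3 * b + 2, 1), (3 * b + 2, 2), (3 * b + 1, 1), (3 * b + 1, 2 :: nat)]"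
    for b :: nat
  define Q where "Q b = [(3 * b + 4, 3), (3 * b + 3, 0), (3 * b + 3, 3), (3 * b + 2, 0), (3 * b + 3, 1), (3 * b + 3, 2 :: nat)]"
    for b :: nat
  define Z where "Z = [(k - 1, 0), (k, 0), (0, 3), (1, 3), (0, 2), (k, 2 :: nat)]"
  define cs where "cs = Z # map P [0..<q] @ map Q [0..<q - 1]"
  have s: "successively (strip_edge k h 0) (xs @ [hd xs])" if "xs \<in> set cs" for xs
  proof -
    consider "xs = Z" | b where "b < q" "xs = P b" | b where "b < q - 1" "xs = Q b"
      using \<open>xs \<in> set cs\<close> by (auto simp: cs_def)
    then show ?thesis
    proof cases
      case 1 then show ?thesis using q k
        by (simp add: Z_def strip_edge_defs)
    next
      case 2 then show ?thesis using q k
        by (simp add: P_def strip_edge_defs)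
    next
      case 3 then show ?thesis using q k
        by (simp add: Q_def strip_edge_defs) presburger
    qed
  qed
  have "u \<in> (\<Union>xs \<in> set cs. set xs)" if "u \<in> strip k" for u
  proof -
    obtain j z where u: "u = (j, z)" by (metis surj_pair)
    have PP: "u \<in> (\<Union>xs \<in> set cs. set xs)" if "b < q" "u \<in> set (P b)" for b
      using that by (auto simp: cs_def)
    have QQ: "u \<in> (\<Union>xs \<in> set cs. set xs)" if "b < q - 1" "u \<in> set (Q b)" for b
      using that by (auto simp: cs_def)
    have ZZ: "u \<in> (\<Union>xs \<in> set cs. set xs)" if "u \<in> set Z" using that by (auto simp: cs_def)
    show ?thesis
    proof (cases "1 \<le> j \<and> j < k")
      case False
      then show ?thesis using ZZ \<open>u \<in> strip k\<close> by (auto simp: u strip_def Z_def)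
    next
      case True
      then have z: "z = 0 \<or> z = 1 \<or> z = 2 \<or> z = 3" using \<open>u \<in> strip k\<close> by (auto simp: u strip_def)
      define b where "b = (j - 1) div 3"
      have b: "b < q" using True k by (auto simp: b_def)
      have "j = 3 * b + 1 \<or> j = 3 * b + 2 \<or> j = 3 * b + 3" using True unfolding b_def by presburger
      then show ?thesis
      proof (elim disjE)
        assume j: "j = 3 * b + 1"
        show ?thesis
        proof (cases "z = 3")
          case True
          then show ?thesis
            using ZZ QQ[of "b - 1"] b j by (cases b) (auto simp: u Z_def Q_def)
        next
          case False then show ?thesis using PP[OF b] z j by (auto simp: u P_def)
        qed
      next
        assume j: "j = 3 * b + 2"
        show ?thesis
        proof (cases "z = 0")
          case True
          then have "j = k - 1 \<or> b < q - 1" using b j k by auto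
          then show ?thesis using True ZZ QQ[of b] j by (auto simp: u Z_def Q_def)
        next
          case False then show ?thesis using PP[OF b] z j by (auto simp: u P_def)
        qed
      next
        assume j: "j = 3 * b + 3"
        then show ?thesis using QQ[of b] z True k by (auto simp: u Q_def)
      qed
    qed
  qed
  then have un: "strip k \<subseteq> (\<Union>xs \<in> set cs. set xs)" by blast
  have len: "length xs = 6" if "xs \<in> set cs" for xs
    using that by (auto simp: cs_def Z_def P_def Q_def)
  have card: "length cs * 6 = card (strip k)"
    using card_strip[of k] q k by (simp add: cs_def)
  show ?thesis using tilesI[OF len _ s un card] by auto
qed

text \<open>The blocks are now the full columns \<open>3 * b + 2\<close> to
  \<open>3 * b + 4\<close>. In columns \<open>1\<close> and \<open>k - 1\<close> the edge between
  letters \<open>0\<close> and \<open>3\<close> serves the diverted cycles of labels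
  \<open>2\<close> and \<open>1\<close> respectively, and in return the 1-factor takes the two edges
  that this label would have used there. The columns \<open>0\<close> and \<open>k\<close> are
  matched with each other.\<close>

lemma tiles_one_factor:
  assumes q: "2 \<le> q" and k: "k = 3 * q"
  shows "\<exists>cs. tiles 2 (strip k) (strip_edge k h (2 * k - 1)) cs"
proof -
  define P where "P b = [[(3 * b + 2, 0), (3 * b + 2, 3)], [(3 * b + 2, 1), (3 * b + 3, 2)],
      [(3 * b + 2, 2), (3 * b + 3, 3)], [(3 * b + 3, 1), (3 * b + 4, 2)],
      [(3 * b + 3, 0), (3 * b + 4, 1)], [(3 * b + 4, 0), (3 * b + 4, 3 :: nat)]]"
    for b :: nat
  define Z where "Z = [[(1, 0), (1, 1)], [(1, 2), (1, 3)], [(k - 1, 0), (k - 1, 2)],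
      [(k - 1, 1), (k - 1, 3)], [(0, 2), (k, 0)], [(0, 3), (k, 2 :: nat)]]"
  define cs where "cs = Z @ concat (map P [0..<q - 1])"
  have edge: "strip_edge k h (2 * k - 1) (xs ! 0) (xs ! 1)" if "xs \<in> set cs" for xs
  proof -
    have "\<forall>xs \<in> set Z. strip_edge k h (2 * k - 1) (xs ! 0) (xs ! 1)"
      using q k by (simp add: Z_def strip_edge_defs)
    moreover have "\<forall>xs \<in> set (P b). strip_edge k h (2 * k - 1) (xs ! 0) (xs ! 1)" if "b < q - 1" for b
    proof -
      have "\<not> 3 dvd 3 * b + 2" "\<not> 3 dvd 3 * b + 4" "(3 * b + 2) mod 3 = 2" "3 * b + 4 < k - 1" "3 * b + 4 \<noteq> k" "3 * b + 3 \<noteq> k"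
        using that k by presburger+
      then show ?thesis
        by (simp add: P_def strip_edge_defs)
    qed
    ultimately show ?thesis using \<open>xs \<in> set cs\<close> by (auto simp: cs_def)
  qed
  have "u \<in> (\<Union>xs \<in> set cs. set xs)" if "u \<in> strip k" for u
  proof -
    obtain j z where u: "u = (j, z)" by (metis surj_pair)
    have PP: "u \<in> (\<Union>xs \<in> set cs. set xs)" if "b < q - 1" "u \<in> (\<Union>xs \<in> set (P b). set xs)" for b
    proof -
      have "set (P b) \<subseteq> set cs" using that(1) by (auto simp: cs_def)
      then show ?thesis using that(2) by blast
    qed
    have ZZ: "u \<in> (\<Union>xs \<in> set cs. set xs)" if "u \<in> (\<Union>xs \<in> set Z. set xs)"
      using that by (auto simp: cs_def)
    show ?thesis
    proof (cases "2 \<le> j \<and> j < k - 1")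
      case False
      then have "j = 0 \<or> j = 1 \<or> j = k - 1 \<or> j = k" using \<open>u \<in> strip k\<close> by (auto simp: u strip_def)
      moreover have "z = 0 \<or> z = 1 \<or> z = 2 \<or> z = 3" "j = 0 \<Longrightarrow> z = 2 \<or> z = 3" "j = k \<Longrightarrow> z = 0 \<or> z = 2"
        using \<open>u \<in> strip k\<close> q k by (auto simp: u strip_def)
      ultimately have "u \<in> (\<Union>xs \<in> set Z. set xs)"
        by (elim disjE) (simp_all add: u Z_def)
      then show ?thesis by (rule ZZ)
    next
      case True
      then have z: "z = 0 \<or> z = 1 \<or> z = 2 \<or> z = 3" using \<open>u \<in> strip k\<close> by (auto simp: u strip_def)
      define b where "b = (j - 2) div 3"
      have "j = 3 * b + 2 \<or> j = 3 * b + 3 \<or> j = 3 * b + 4" using True unfolding b_def by presburger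
      moreover have "b < q - 1" using True k by (auto simp: b_def)
      ultimately show ?thesis
        using z by (intro PP[of b]) (elim disjE; simp add: u P_def)+
    qed
  qed
  then have un: "strip k \<subseteq> (\<Union>xs \<in> set cs. set xs)" by blast
  have len: "length xs = 2" if "xs \<in> set cs" for xs
    using that by (auto simp: cs_def Z_def P_def)
  have s: "successively (strip_edge k h (2 * k - 1)) (xs @ [hd xs])" if xs: "xs \<in> set cs" for xs
  proof -
    obtain u w where "xs = [u, w]"
      using len[OF xs] by (auto simp: numeral_2_eq_2 length_Suc_conv)
    then show ?thesis using edge[OF xs] strip_edge_sym by auto
  qed
  have "length (concat (map P bs)) = 6 * length bs" for bs
    by (induction bs) (auto simp: P_def)
  then have card: "length cs * 2 = card (strip k)"
    using card_strip[of k] q k by (simp add: cs_def Z_def)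
  show ?thesis using tilesI[OF len _ s un card] by auto
qed

section \<open>The two factors into long cycles\<close>

lemma strip_edge_1_cut:
  "Suc j < k \<Longrightarrow> strip_edge k h 1 (j, 3) (Suc j, 0)"
  "Suc j < k \<Longrightarrow> strip_edge k h 1 (j, 2) (Suc j, 1)"
  by (simp_all add: strip_edge_defs)

lemma strip_edge_1_column:
  "\<not> h dvd j \<Longrightarrow> j \<noteq> k - 1 \<Longrightarrow> strip_edge k h 1 (j, 0) (j, 2)"
  "\<not> h dvd j \<Longrightarrow> j \<noteq> k - 1 \<Longrightarrow> strip_edge k h 1 (j, 1) (j, 3)"
  "h dvd j \<Longrightarrow> j \<noteq> 1 \<Longrightarrow> strip_edge k h 1 (j, 0) (j, 1)"
  "h dvd j \<Longrightarrow> j \<noteq> 1 \<Longrightarrow> strip_edge k h 1 (j, 2) (j, 3)"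
  by (simp_all add: strip_edge_defs)

lemma strip_edge_1_end:
  assumes "3 \<le> k"
  shows "successively (strip_edge k h 1) [(k - 1, 0), (k - 1, 3), (k, 0), (k - 1, 2), (k, 2), (k - 1, 1)]"
    "successively (strip_edge k h 1) [(k - 1, 1), (k, 2), (k - 1, 2), (k, 0), (k - 1, 3), (k - 1, 0)]"
  using assms by (cases k; simp add: strip_edge_defs)+

lemma strip_edge_2_cut:
  "0 < j \<Longrightarrow> Suc j \<le> k \<Longrightarrow> strip_edge k h 2 (j, 3) (Suc j, 2)"
  "0 < j \<Longrightarrow> Suc j \<le> k \<Longrightarrow> strip_edge k h 2 (j, 1) (Suc j, 0)"
  by (simp_all add: strip_edge_defs)

lemma strip_edge_2_column:
  "\<not> h dvd j \<Longrightarrow> j \<noteq> 1 \<Longrightarrow> strip_edge k h 2 (j, 2) (j, 3)"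
  "\<not> h dvd j \<Longrightarrow> j \<noteq> 1 \<Longrightarrow> strip_edge k h 2 (j, 0) (j, 1)"
  "h dvd j \<Longrightarrow> j \<noteq> k - 1 \<Longrightarrow> strip_edge k h 2 (j, 0) (j, 2)"
  "h dvd j \<Longrightarrow> j \<noteq> k - 1 \<Longrightarrow> strip_edge k h 2 (j, 1) (j, 3)"
  by (simp_all add: strip_edge_defs)

lemma strip_edge_2_start:
  "3 \<le> k \<Longrightarrow> successively (strip_edge k h 2) [(1, 1), (0, 3), (1, 2), (0, 2), (1, 0), (1, 3)]"
  by (simp add: strip_edge_defs)

text \<open>Between columns letter \<open>3\<close> leads to \<open>0\<close> and \<open>2\<close>
  to \<open>1\<close>; inside an uncut column \<open>0\<close> leads to \<open>2\<close> and
  \<open>1\<close> to \<open>3\<close>, so two strands twist around each other. A cycle runs from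
  the letters \<open>2, 3\<close> of column \<open>h * r\<close> to the letters \<open>0, 1\<close>
  of column \<open>h * (r + 1)\<close>, closed there by the edges exchanged at the cuts. Column
  \<open>0\<close> has exactly the letters \<open>2, 3\<close>, but column \<open>k\<close> lacks
  \<open>1\<close>, so the last cycle is diverted.\<close>

lemma tiles_long_cycles_1:
  assumes h: "2 \<le> h" and s: "2 \<le> s" and k: "k = h * s"
  shows "\<exists>cs. tiles (4 * h) (strip k) (strip_edge k h 1) cs"
proof -
  let ?P = "strip_edge k h 1"
  define S where "S r n = (h * r + Suc n div 2, Suc (Suc n div 2) mod 2 + (if even n then 2 else 0))" for r n
  define T where "T r n = (h * r + Suc n div 2, Suc n div 2 mod 2 + (if even n then 2 else 0))" for r n
  \<comment> \<open>\<open>S\<close> enters column \<open>k - 1\<close> in letter \<open>0\<close>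
    if \<open>h\<close> is even and in \<open>1\<close> if \<open>h\<close> is odd, which fixes the
    direction of the detour.\<close>
  define Z where "Z = (if even h then [(k - 1, 3), (k, 0), (k - 1, 2), (k, 2)] else [(k, 2), (k - 1, 2), (k, 0), (k - 1, 3 :: nat)])"
  define A where "A r = strand_cycle (S r) (T r) 0 (2 * h) [] []" for r
  define B where "B = strand_cycle (S (s - 1)) (T (s - 1)) 0 (2 * h - 2) Z []"
  define cs where "cs = B # map A [0..<s - 1]"
  have S_even: "S r (2 * i) = (h * r + i, Suc i mod 2 + 2)" and T_even: "T r (2 * i) = (h * r + i, i mod 2 + 2)" for r i
    by (simp_all add: S_def T_def)
  have S_odd: "S r (2 * i + 1) = (h * r + Suc i, i mod 2)" and T_odd: "T r (2 * i + 1) = (h * r + Suc i, Suc i mod 2)" for r i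
    by (simp_all add: S_def T_def)
  have lek: "h * Suc r \<le> k" if "r < s" for r using that k by (simp del: mult_Suc_right)
  have ndvd: "\<not> h dvd h * r + i" if "0 < i" "i < h" for r i
    using that dvd_add_right_iff[of h "h * r" i] by (auto dest: dvd_imp_le)
  have par: "i mod 2 = 0 \<and> Suc i mod 2 = 1 \<or> i mod 2 = 1 \<and> Suc i mod 2 = 0" for i :: nat by presburger
  have step: "?P (S r n) (S r (Suc n)) \<and> ?P (T r n) (T r (Suc n))"
    if n: "Suc n < 2 * h" and r: "r < s" and last: "r = s - 1 \<Longrightarrow> Suc n < 2 * h - 2" for r n
  proof (cases "even n")
    case True
    then obtain i where i: "n = 2 * i" by blast
    have "h * r + Suc i < k"
    proof (cases "r = s - 1")
      case True
      then show ?thesis using last i lek[OF r] by simp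
    next
      case False
      then have "h * Suc (Suc r) \<le> k" using lek[of "Suc r"] r by simp
      then show ?thesis using n i h by simp
    qed
    then show ?thesis
      using par[of i] strip_edge_1_cut[of "h * r + i" k h] S_even[of r i] T_even[of r i] S_odd[of r i] T_odd[of r i]
      by (elim disjE conjE) (simp_all add: i numeral_2_eq_2[symmetric] numeral_3_eq_3[symmetric])
  next
    case False
    then obtain i where i: "n = 2 * i + 1" by (rule oddE)
    have "h * r + Suc i \<noteq> k - 1"
    proof (cases "r = s - 1")
      case True
      then show ?thesis using last i lek[OF r] by simp
    next
      case False
      then have "h * Suc (Suc r) \<le> k" using lek[of "Suc r"] r by simp
      then show ?thesis using n i h by simp
    qed
    moreover have "\<not> h dvd h * r + Suc i" using ndvd[of "Suc i" r] n i by simp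
    ultimately show ?thesis
      using par[of i] strip_edge_1_column(1,2)[of h "h * r + Suc i" k]
        S_odd[of r i] T_odd[of r i] S_even[of r "Suc i"] T_even[of r "Suc i"]
      by (elim disjE conjE) (simp_all add: i numeral_2_eq_2[symmetric] numeral_3_eq_3[symmetric])
  qed
  have start: "?P (T r 0) (S r 0)" for r
    using h S_even[of r 0] T_even[of r 0] strip_edge_1_column(4)[of h "h * r" k]
    by (simp add: numeral_2_eq_2[symmetric] numeral_3_eq_3[symmetric])
  have col: "h * r + h \<noteq> 1" for r using h by simp
  have turn: "?P (S r (2 * h - 1)) (T r (2 * h - 1))" for r
  proof -
    have "2 * h - 1 = 2 * (h - 1) + 1" using h by simp
    then have "S r (2 * h - 1) = (h * r + h, (h - 1) mod 2)" "T r (2 * h - 1) = (h * r + h, h mod 2)"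
      using S_odd[of r "h - 1"] T_odd[of r "h - 1"] h by simp_all
    moreover have "?P (h * r + h, 0) (h * r + h, 1)" using strip_edge_1_column(3) col[of r] by simp
    ultimately show ?thesis using par[of "h - 1"] h strip_edge_sym[of k h 1 "(h * r + h, 0)"]
      by (elim disjE conjE) simp_all
  qed
  have last: "h * (s - 1) + h = k" using s k by (cases s) simp_all
  have turn': "successively ?P (S (s - 1) (2 * h - 2 - 1) # Z @ [T (s - 1) (2 * h - 2 - 1)])"
  proof -
    obtain h' where h': "h = Suc (Suc h')" using h by (metis Suc_le_D numeral_2_eq_2 Suc_le_mono)
    have "2 * h - 2 - 1 = 2 * h' + 1" "h * (s - 1) + Suc h' = k - 1" using last h' by simp_all
    then have "S (s - 1) (2 * h - 2 - 1) = (k - 1, h' mod 2)" "T (s - 1) (2 * h - 2 - 1) = (k - 1, Suc h' mod 2)"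
      using S_odd[of "s - 1" h'] T_odd[of "s - 1" h'] by simp_all
    moreover have "even h \<longleftrightarrow> h' mod 2 = 0 \<and> Suc h' mod 2 = 1" "odd h \<longleftrightarrow> h' mod 2 = 1 \<and> Suc h' mod 2 = 0"
      unfolding h' by presburger+
    moreover have "2 * 2 \<le> k" unfolding k using h s by (rule mult_le_mono)
    ultimately show ?thesis using strip_edge_1_end[of k h]
      by (cases "even h") (simp_all add: Z_def)
  qed
  have succ: "successively ?P (xs @ [hd xs])" if "xs \<in> set cs" for xs
  proof -
    have "successively ?P (A r @ [hd (A r)])" if r: "r < s - 1" for r
      unfolding A_def
    proof (rule successively_strand_cycle)
      show "?P (S r i) (S r (Suc i))" "?P (T r i) (T r (Suc i))" if "Suc i < 2 * h" for i
        using step[OF that] r by auto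
      show "successively ?P (S r (2 * h - 1) # [] @ [T r (2 * h - 1)])" using turn by simp
      show "successively ?P (T r 0 # [] @ [S r 0])" using start by simp
    qed (use h strip_edge_sym in auto)
    moreover have "successively ?P (B @ [hd B])"
      unfolding B_def
    proof (rule successively_strand_cycle)
      show "?P (S (s - 1) i) (S (s - 1) (Suc i))" "?P (T (s - 1) i) (T (s - 1) (Suc i))"
        if "Suc i < 2 * h - 2" for i
        using step[of i "s - 1"] that s by auto
      show "successively ?P (T (s - 1) 0 # [] @ [S (s - 1) 0])" using start by simp
    qed (use h strip_edge_sym turn' in auto)
    moreover have "xs = B \<or> (\<exists>r < s - 1. xs = A r)" using that by (auto simp: cs_def)
    ultimately show ?thesis by blast
  qed
  have len: "length xs = 4 * h" if "xs \<in> set cs" for xs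
    using that h by (auto simp: cs_def A_def B_def Z_def)
  have "length cs = s" using s by (simp add: cs_def)
  moreover have "2 * 2 \<le> k" unfolding k using h s by (rule mult_le_mono)
  ultimately have card: "length cs * (4 * h) = card (strip k)"
    by (simp add: card_strip k)
  have un: "strip k \<subseteq> (\<Union>xs \<in> set cs. set xs)" (is "_ \<subseteq> ?U")
  proof
    fix u assume u: "u \<in> strip k"
    obtain j z where [simp]: "u = (j, z)" by (metis surj_pair)
    have mem_A: "S r n \<in> ?U" "T r n \<in> ?U" if "r < s - 1" "n < 2 * h" for r n
    proof -
      have "A r \<in> set cs" "S r n \<in> set (A r)" "T r n \<in> set (A r)"
        using that by (auto simp: cs_def A_def)
      then show "S r n \<in> ?U" "T r n \<in> ?U" by blast+
    qed
    have mem_B: "S r n \<in> ?U" "T r n \<in> ?U" if "r = s - 1" "n < 2 * h - 2" for r n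
    proof -
      have "B \<in> set cs" "S r n \<in> set B" "T r n \<in> set B"
        using that by (auto simp: cs_def B_def)
      then show "S r n \<in> ?U" "T r n \<in> ?U" by blast+
    qed
    have mem: "S r n \<in> ?U" "T r n \<in> ?U" if "r < s" "n < 2 * h" "r = s - 1 \<Longrightarrow> n < 2 * h - 2" for r n
      using mem_A[of r n] mem_B[of r n] that by (cases "r = s - 1"; simp)+
    have exit: "(h * r + i, z) \<in> ?U" if "r < s" "2 * i < 2 * h" "r = s - 1 \<Longrightarrow> 2 * i < 2 * h - 2" "z = 2 \<or> z = 3"
      for r i z
      using mem[OF that(1-3)] S_even[of r i] T_even[of r i] par[of i] that(4)
      by (elim disjE conjE) (simp_all add: numeral_2_eq_2[symmetric] numeral_3_eq_3[symmetric])
    have entry: "(h * r + Suc i, z) \<in> ?U"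
      if "r < s" "2 * i + 1 < 2 * h" "r = s - 1 \<Longrightarrow> 2 * i + 1 < 2 * h - 2" "z = 0 \<or> z = 1" for r i z
      using mem[OF that(1-3)] S_odd[of r i] T_odd[of r i] par[of i] that(4)
      by (elim disjE conjE) simp_all
    have "set Z \<subseteq> ?U" by (auto simp: cs_def B_def)
    then have Z: "(k - 1, 2) \<in> ?U" "(k - 1, 3) \<in> ?U" "(k, 0) \<in> ?U" "(k, 2) \<in> ?U"
      by (auto simp: Z_def split: if_splits)
    have z: "z = 0 \<or> z = 1 \<or> z = 2 \<or> z = 3" "j \<le> k" "j = k \<Longrightarrow> z = 0 \<or> z = 2" "j = 0 \<Longrightarrow> z = 2 \<or> z = 3"
      using u \<open>2 * 2 \<le> k\<close> by (auto simp: strip_def)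
    show "u \<in> ?U"
    proof (cases "z = 2 \<or> z = 3")
      case True
      define r i where "r = j div h" and "i = j mod h"
      have j: "j = h * r + i" "i < h" using h by (simp_all add: r_def i_def)
      show ?thesis
      proof (cases "j < k - 1")
        case True
        note jk = this and z23 = \<open>z = 2 \<or> z = 3\<close>
        then have "h * r < h * s" using jk j k by linarith
        then have "r < s" by simp
        moreover have "r = s - 1 \<Longrightarrow> 2 * i < 2 * h - 2" using jk j last by auto
        ultimately show ?thesis using exit[of r i z] z23 j by simp
      next
        case False
        then have "j = k - 1 \<or> j = k" using z by auto
        then show ?thesis using Z True z(3) by auto
      qed
    next
      case False
      then have z01: "z = 0 \<or> z = 1" "0 < j" using z by auto
      show ?thesis
      proof (cases "j = k")
        case True then show ?thesis using Z z False by auto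
      next
        case False
        define r i where "r = (j - 1) div h" and "i = (j - 1) mod h"
        have "j - 1 = h * r + i" "i < h" using h by (simp_all add: r_def i_def)
        then have j: "j = h * r + Suc i" "i < h" using z01 by simp_all
        then have "h * r < h * s" using z False k by linarith
        then have "r < s" by simp
        moreover have "r = s - 1 \<Longrightarrow> 2 * i + 1 < 2 * h - 2" using False j last z(2) by auto
        ultimately show ?thesis using entry[of r i z] z01 j by simp
      qed
    qed
  qed
  show ?thesis using tilesI[OF len _ succ un card] h by auto
qed

text \<open>These strands do not twist: one uses the letters \<open>3, 2\<close>, the other
  \<open>1, 0\<close>. The ends change roles: column \<open>k\<close> has exactly the letters
  \<open>0, 2\<close> in which a cycle ends, but column \<open>0\<close> lacks \<open>1\<close>, so
  the first cycle is diverted.\<close>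

lemma tiles_long_cycles_2:
  assumes h: "2 \<le> h" and s: "2 \<le> s" and k: "k = h * s"
  shows "\<exists>cs. tiles (4 * h) (strip k) (strip_edge k h 2) cs"
proof -
  let ?P = "strip_edge k h 2"
  define S where "S r n = (h * r + Suc n div 2, if even n then 3 else 2 :: nat)" for r n
  define T where "T r n = (h * r + Suc n div 2, if even n then 1 else 0 :: nat)" for r n
  define Z where "Z = [(0, 3), (1, 2), (0, 2), (1 :: nat, 0 :: nat)]"
  define A where "A r = strand_cycle (S r) (T r) 0 (2 * h) [] []" for r
  \<comment> \<open>Position \<open>2\<close> is column \<open>1\<close>, where the strands start in
    the letters \<open>3\<close> and \<open>1\<close>; \<open>Z\<close> supplies column
    \<open>0\<close> and the other two points of column \<open>1\<close>.\<close>
  define B where "B = strand_cycle (S 0) (T 0) 2 (2 * h) [] Z"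
  define cs where "cs = B # map A [1..<s]"
  have S_even: "S r (2 * i) = (h * r + i, 3)" and T_even: "T r (2 * i) = (h * r + i, 1)" for r i
    by (simp_all add: S_def T_def)
  have S_odd: "S r (2 * i + 1) = (h * r + Suc i, 2)" and T_odd: "T r (2 * i + 1) = (h * r + Suc i, 0)" for r i
    by (simp_all add: S_def T_def)
  have lek: "h * Suc r \<le> k" if "r < s" for r using that k by (simp del: mult_Suc_right)
  have k4: "2 * 2 \<le> k" unfolding k using h s by (rule mult_le_mono)
  have ndvd: "\<not> h dvd h * r + i" if "0 < i" "i < h" for r i
    using that dvd_add_right_iff[of h "h * r" i] by (auto dest: dvd_imp_le)
  have pos: "h \<le> h * r" if "0 < r" for r using that by simp
  have step: "?P (S r n) (S r (Suc n)) \<and> ?P (T r n) (T r (Suc n))"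
    if n: "Suc n < 2 * h" and r: "r < s" and first: "r = 0 \<Longrightarrow> 2 \<le> n" for r n
  proof (cases "even n")
    case True
    then obtain i where i: "n = 2 * i" by blast
    have "0 < h * r + i" using first pos[of r] h i by (cases "r = 0") auto
    moreover have "Suc (h * r + i) \<le> k" using lek[OF r] n i by simp
    ultimately show ?thesis
      using strip_edge_2_cut[of "h * r + i" k h] S_even[of r i] T_even[of r i] S_odd[of r i] T_odd[of r i]
      by (simp add: i)
  next
    case False
    then obtain i where i: "n = 2 * i + 1" by (rule oddE)
    have "h * r + Suc i \<noteq> 1" using first pos[of r] h i by (cases "r = 0") auto
    moreover have "\<not> h dvd h * r + Suc i" using ndvd[of "Suc i" r] n i by simp
    ultimately show ?thesis
      using strip_edge_2_column(1,2)[of h "h * r + Suc i" k]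
        S_odd[of r i] T_odd[of r i] S_even[of r "Suc i"] T_even[of r "Suc i"]
      by (simp add: i)
  qed
  have nk: "h * r \<noteq> k - 1" if "r \<le> s" for r
  proof (cases "r = s")
    case True then show ?thesis using k k4 by simp
  next
    case False
    then have "h * Suc r \<le> k" using that lek[of r] by simp
    then show ?thesis using h by simp
  qed
  have start: "?P (T r 0) (S r 0)" if "r < s" for r
    using S_even[of r 0] T_even[of r 0] strip_edge_2_column(4)[of h "h * r" k] nk[of r] that by simp
  have turn: "?P (S r (2 * h - 1)) (T r (2 * h - 1))" if "r < s" for r
  proof -
    have "2 * h - 1 = 2 * (h - 1) + 1" using h by simp
    then have "S r (2 * h - 1) = (h * Suc r, 2)" "T r (2 * h - 1) = (h * Suc r, 0)"
      using S_odd[of r "h - 1"] T_odd[of r "h - 1"] h by simp_all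
    moreover have "?P (h * Suc r, 0) (h * Suc r, 2)"
      using strip_edge_2_column(3)[of h "h * Suc r" k] nk[of "Suc r"] that by simp
    ultimately show ?thesis using strip_edge_sym by simp
  qed
  have start': "successively ?P (T 0 2 # Z @ [S 0 2])"
    using strip_edge_2_start[of k h] k4 S_even[of 0 1] T_even[of 0 1] by (simp add: Z_def)
  have succ: "successively ?P (xs @ [hd xs])" if "xs \<in> set cs" for xs
  proof -
    have "successively ?P (A r @ [hd (A r)])" if r: "0 < r" "r < s" for r
      unfolding A_def
    proof (rule successively_strand_cycle)
      show "?P (S r i) (S r (Suc i))" "?P (T r i) (T r (Suc i))" if "Suc i < 2 * h" for i
        using step[OF that] r by auto
      show "successively ?P (S r (2 * h - 1) # [] @ [T r (2 * h - 1)])" using turn r by simp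
      show "successively ?P (T r 0 # [] @ [S r 0])" using start r by simp
    qed (use h strip_edge_sym in auto)
    moreover have "successively ?P (B @ [hd B])"
      unfolding B_def
    proof (rule successively_strand_cycle)
      show "?P (S 0 i) (S 0 (Suc i))" "?P (T 0 i) (T 0 (Suc i))" if "2 \<le> i" "Suc i < 2 * h" for i
        using step[of i 0] that s by auto
      show "successively ?P (S 0 (2 * h - 1) # [] @ [T 0 (2 * h - 1)])" using turn s by simp
    qed (use h strip_edge_sym start' in auto)
    moreover have "xs = B \<or> (\<exists>r < s. 0 < r \<and> xs = A r)" using that by (auto simp: cs_def)
    ultimately show ?thesis by blast
  qed
  have len: "length xs = 4 * h" if "xs \<in> set cs" for xs
    using that h by (auto simp: cs_def A_def B_def Z_def)
  have "length cs = s" using s by (simp add: cs_def)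
  then have card: "length cs * (4 * h) = card (strip k)"
    using k4 by (simp add: card_strip k)
  have un: "strip k \<subseteq> (\<Union>xs \<in> set cs. set xs)" (is "_ \<subseteq> ?U")
  proof
    fix u assume u: "u \<in> strip k"
    obtain j z where [simp]: "u = (j, z)" by (metis surj_pair)
    have mem_A: "S r n \<in> ?U" "T r n \<in> ?U" if "0 < r" "r < s" "n < 2 * h" for r n
    proof -
      have "A r \<in> set cs" "S r n \<in> set (A r)" "T r n \<in> set (A r)"
        using that by (auto simp: cs_def A_def)
      then show "S r n \<in> ?U" "T r n \<in> ?U" by blast+
    qed
    have mem_B: "S 0 n \<in> ?U" "T 0 n \<in> ?U" if "2 \<le> n" "n < 2 * h" for n
    proof -
      have "B \<in> set cs" "S 0 n \<in> set B" "T 0 n \<in> set B"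
        using that by (auto simp: cs_def B_def)
      then show "S 0 n \<in> ?U" "T 0 n \<in> ?U" by blast+
    qed
    have mem: "S r n \<in> ?U" "T r n \<in> ?U" if "r < s" "n < 2 * h" "r = 0 \<Longrightarrow> 2 \<le> n" for r n
      using mem_A[of r n] mem_B[of n] that by (cases "r = 0"; simp)+
    have "set Z \<subseteq> ?U" by (auto simp: cs_def B_def)
    then have Z: "(0, 3) \<in> ?U" "(1, 2) \<in> ?U" "(0, 2) \<in> ?U" "(1, 0) \<in> ?U" by (auto simp: Z_def)
    have z: "z = 0 \<or> z = 1 \<or> z = 2 \<or> z = 3" "j \<le> k" "j = k \<Longrightarrow> z = 0 \<or> z = 2" "j = 0 \<Longrightarrow> z = 2 \<or> z = 3"
      using u k4 by (auto simp: strip_def)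
    show "u \<in> ?U"
    proof (cases "j = 0")
      case True then show ?thesis using Z z by auto
    next
      case j0: False
      show ?thesis
      proof (cases "z = 1 \<or> z = 3")
        case True
        define r i where "r = j div h" and "i = j mod h"
        have j: "j = h * r + i" "i < h" using h by (simp_all add: r_def i_def)
        have "j \<noteq> k" using z(3) True by auto
        then have "j < k" using z(2) by simp
        then have "h * r < h * s" using j k by linarith
        then have "r < s" by simp
        moreover have "r = 0 \<Longrightarrow> 2 \<le> 2 * i" using j0 j by auto
        ultimately show ?thesis
          using mem[of r "2 * i"] S_even[of r i] T_even[of r i] j True by auto
      next
        case False
        then have z02: "z = 0 \<or> z = 2" using z by auto
        show ?thesis
        proof (cases "j = 1")
          case True then show ?thesis using Z z02 by auto
        next
          case False
          define r i where "r = (j - 1) div h" and "i = (j - 1) mod h"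
          have "j - 1 = h * r + i" "i < h" using h by (simp_all add: r_def i_def)
          then have j: "j = h * r + Suc i" "i < h" using j0 by simp_all
          then have "h * r < h * s" using z k by linarith
          then have "r < s" by simp
          moreover have "r = 0 \<Longrightarrow> 2 \<le> 2 * i + 1" using False j0 j by auto
          ultimately show ?thesis
            using mem[of r "2 * i + 1"] S_odd[of r i] T_odd[of r i] j z02 by auto
        qed
      qed
    qed
  qed
  show ?thesis using tilesI[OF len _ succ un card] h by auto
qed

section \<open>Assembly of all factors\<close>

lemma HWP_solution_long:
  assumes h: "2 \<le> h" and t: "0 < t" and x: "x = 2 * h"
  shows "\<exists>F G. HWP_solution (6 * x * t) 6 (2 * x) 1 (3 * x * t - 2) F G"
proof -
  \<comment> \<open>The hexagons need \<open>3\<close> to divide \<open>k\<close>, the cuts need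
    \<open>h\<close> to divide \<open>k\<close>, and the doubled Hamiltonian cycles need
    \<open>x\<close> to divide \<open>2 * k\<close>.\<close>
  define q where "q = h * t"
  define k where "k = 3 * q"
  have kx: "2 * k = 3 * x * t" and ks: "k = h * (3 * t)" by (simp_all add: k_def q_def x)
  have "2 * 1 \<le> h * t" using h t by (intro mult_le_mono) auto
  then have q: "2 \<le> q" by (simp add: q_def)
  then have k: "3 \<le> k" by (simp add: k_def)
  let ?f = "\<lambda>u w. strip_lab k h (to_strip k u) (to_strip k w)"
  let ?V = "{..<2 * k} \<times> (UNIV :: bool set)"
  have sym: "?f u w = ?f w u" for u w by (rule strip_lab_commute)
  have card: "card ?V = 6 * x * t" using kx by (simp add: card_cartesian_product)
  have cx: "2 * x = 4 * h" by (simp add: x)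
  have "\<exists>F G. HWP_solution (card ?V) 6 (2 * x) 1 (3 * x * t - 2) F G"
  proof (rule HWP_solutionI[where lab = "full_lab k x ?f"])
    show "card ?V = 2 * (1 + (3 * x * t - 2)) + 2" using card kx k by simp
    show "3 \<le> 2 * x" using h x by simp
    show "full_lab k x ?f u w = full_lab k x ?f w u" for u w by (rule full_lab_commute) (rule sym)
    show "\<exists>cs. tiles 6 ?V (\<lambda>u w. full_lab k x ?f u w = i) cs" if "i < 1" for i
    proof -
      obtain cs where "tiles 6 (strip k) (strip_edge k h 0) cs"
        using tiles_hexagons[OF q k_def] by blast
      from tiles_full_lab[OF k this] show ?thesis using that by simp
    qed
    show "\<exists>cs. tiles (2 * x) ?V (\<lambda>u w. full_lab k x ?f u w = i) cs"
      if i: "1 \<le> i" "i < 1 + (3 * x * t - 2)" for i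
    proof -
      have s: "2 \<le> 3 * t" using t by simp
      consider "i = 1" | "i = 2" | "3 \<le> i" using i by linarith
      then show ?thesis
      proof cases
        case 1
        obtain cs where "tiles (2 * x) (strip k) (strip_edge k h 1) cs"
          using tiles_long_cycles_1[OF h s ks] unfolding cx by blast
        from tiles_full_lab[OF k this] show ?thesis using 1 by simp
      next
        case 2
        obtain cs where "tiles (2 * x) (strip k) (strip_edge k h 2) cs"
          using tiles_long_cycles_2[OF h s ks] unfolding cx by blast
        from tiles_full_lab[OF k this] show ?thesis using 2 by simp
      next
        case 3
        \<comment> \<open>Labels \<open>3\<close> to \<open>2 * k - 2\<close> belong to the cycles
          \<open>1\<close> to \<open>k - 2\<close>; cycle \<open>0\<close>, made of the sums
          \<open>1\<close> and \<open>2\<close>, has gone into the ladder.\<close>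
        define n where "n = (i - 1) div 2"
        have "i = 2 * n + 1 \<or> i = 2 * n + 2" using 3 unfolding n_def by presburger
        moreover have "1 \<le> n" "n + 2 \<le> k" using 3 i kx unfolding n_def by presburger+
        ultimately show ?thesis
          using h x kx by (intro tiles_doubled_gk_cycle[OF _ _ _ _ _ _ sym]) auto
      qed
    qed
    have F: "1 + (3 * x * t - 2) = 2 * k - 1" using kx k by simp
    obtain cs where "tiles 2 (strip k) (strip_edge k h (2 * k - 1)) cs"
      using tiles_one_factor[OF q k_def] by blast
    from tiles_full_lab[OF k this]
    show "\<exists>cs. tiles 2 ?V (\<lambda>u w. full_lab k x ?f u w = 1 + (3 * x * t - 2)) cs"
      unfolding F by simp
  qed auto
  then show ?thesis unfolding card .
qed

theorem theorem7:
  fixes x t :: nat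
  assumes "0 < x" and "0 < t"
    and "x mod 6 = 2 \<or> x mod 6 = 4"
  shows "\<exists>F G. HWP_solution (6 * x * t) 6 (2 * x) 1 (3 * x * t - 2) F G"
proof -
  have "even x" using assms(3) by presburger
  then obtain h where x: "x = 2 * h" by blast
  show ?thesis
  proof (cases "h = 1")
    case True
    then show ?thesis using HWP_solution_squares[OF assms(2)] x by simp
  next
    case False
    then have "2 \<le> h" using assms(1) x by simp
    then show ?thesis using HWP_solution_long[OF _ assms(2) x] by blast
  qed
qed

end
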